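(* Let $p>2$, let $\epsilon_0,\epsilon_1>0$, and let $S(\omega)=\{\eta_j(\omega)\}_{1\le j\le L}$ be the random perturbation of an arithmetic progression described in the context (with $L=N^{\epsilon_0}$, $s=N^{\epsilon_1}$). Then $$\mathbb{E}\left(\sup_{|a_n|\le1}\Big\|\sum_{n\in S(\omega)}a_ne(nx)\Big\|_{L^p([0,1])}\right)\le C_p\,\mathbb{E}\left(\Big\|\sum_{n\in S(\omega)}e(nx)\Big\|_{L^p([0,1])}\right)$$ for some $C_p$ not depending on $N$. Therefore, for any $\gamma>0$, there exist constants $C_\gamma$, $C_\gamma'$ such that $$\sup_{N\ge C_\gamma'}\ \mathbb{P}\left(\sup_{|a_n|\le1}\Big\|\sum_{n\in S(\omega)}a_ne(nx)\Big\|_{L^p([0,1])}\ \ge\ C_\gamma\Big\|\sum_{n\in S(\omega)}e(nx)\Big\|_{L^p([0,1])}\right)\le\gamma .$$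
   Context: Write $e(x)=e^{2\pi i x}$. Let $N\gg1$ be a large integer, $\epsilon_0,\epsilon_1>0$, $L=N^{\epsilon_0}$, $s=N^{\epsilon_1}$, and let $a,b$ be integers (depending on $N$) with $0<b<a$, $s<a/2$, and $\{b+aj:1\le j\le L\}\subset[1,N]$. For integers $1\le j\le L$ let $I_j=[(b+aj)-s,(b+aj)+s]$ (the set of integers in this interval). Let $\eta_j(\omega)$, $1\le j\le L$, be independent integer-valued random variables, $\eta_j$ uniformly distributed on $I_j$, and set $S(\omega)=\{\eta_j(\omega):1\le j\le L\}$. The supremum over $|a_n|\le1$ is over all complex sequences $(a_n)$ with absolute value $|a_n|\le 1$ for every $n$. *)

theory Defs
  imports "HOL-Probability.Probability"
begin

definition e :: "real \<Rightarrow> complex" where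
  "e x = exp (2 * complex_of_real pi * \<i> * complex_of_real x)"

definition Lp_norm :: "real \<Rightarrow> (real \<Rightarrow> complex) \<Rightarrow> real" where
  "Lp_norm p f = (LBINT x:{0..1}. norm (f x) powr p) powr (1 / p)"

definition exp_sum :: "(int \<Rightarrow> complex) \<Rightarrow> int set \<Rightarrow> real \<Rightarrow> complex" where
  "exp_sum c S x = (\<Sum>n\<in>S. c n * e (of_int n * x))"

text \<open>For finite \<open>S\<close> (the only case used) the set of norms is bounded above by the
  cardinality of \<open>S\<close>, so the real-valued supremum is a genuine one.\<close>

definition sup_norm :: "real \<Rightarrow> int set \<Rightarrow> real" where
  "sup_norm p S = (SUP c \<in> {c. \<forall>n. norm (c n) \<le> 1}. Lp_norm p (exp_sum c S))"

definition majorant_norm :: "real \<Rightarrow> int set \<Rightarrow> real" where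
  "majorant_norm p S = Lp_norm p (exp_sum (\<lambda>_. 1) S)"

text \<open>The length \<open>N powr \<epsilon>\<^sub>0\<close> and the radius \<open>N powr \<epsilon>\<^sub>1\<close> are real numbers and are
  not rounded; only the index \<open>j\<close> and the elements of the windows are integers.\<close>

definition ap_indices :: "nat \<Rightarrow> real \<Rightarrow> nat set" where
  "ap_indices N \<epsilon>\<^sub>0 = {j. 1 \<le> j \<and> real j \<le> real N powr \<epsilon>\<^sub>0}"

definition ap_window :: "nat \<Rightarrow> real \<Rightarrow> int \<Rightarrow> int \<Rightarrow> nat \<Rightarrow> int set" where
  "ap_window N \<epsilon>\<^sub>1 a b j =
     {n. real_of_int (b + a * int j) - real N powr \<epsilon>\<^sub>1 \<le> real_of_int n \<and>
         real_of_int n \<le> real_of_int (b + a * int j) + real N powr \<epsilon>\<^sub>1}"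

definition admissible :: "nat \<Rightarrow> real \<Rightarrow> real \<Rightarrow> int \<Rightarrow> int \<Rightarrow> bool" where
  "admissible N \<epsilon>\<^sub>0 \<epsilon>\<^sub>1 a b \<longleftrightarrow>
     1 \<le> N \<and> 0 < b \<and> b < a \<and> real N powr \<epsilon>\<^sub>1 < real_of_int a / 2 \<and>
     (\<lambda>j. b + a * int j) ` ap_indices N \<epsilon>\<^sub>0 \<subseteq> {1..int N}"

definition random_perturbation ::
  "'w measure \<Rightarrow> (nat \<Rightarrow> 'w \<Rightarrow> int) \<Rightarrow> nat \<Rightarrow> real \<Rightarrow> real \<Rightarrow> int \<Rightarrow> int \<Rightarrow> bool" where
  "random_perturbation M \<eta> N \<epsilon>\<^sub>0 \<epsilon>\<^sub>1 a b \<longleftrightarrow>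
     prob_space M \<and>
     prob_space.indep_vars M (\<lambda>_. count_space UNIV) \<eta> (ap_indices N \<epsilon>\<^sub>0) \<and>
     (\<forall>j\<in>ap_indices N \<epsilon>\<^sub>0.
        distr M (count_space UNIV) (\<eta> j) = measure_pmf (pmf_of_set (ap_window N \<epsilon>\<^sub>1 a b j)))"

definition random_set :: "(nat \<Rightarrow> 'w \<Rightarrow> int) \<Rightarrow> nat \<Rightarrow> real \<Rightarrow> 'w \<Rightarrow> int set" where
  "random_set \<eta> N \<epsilon>\<^sub>0 \<omega> = (\<lambda>j. \<eta> j \<omega>) ` ap_indices N \<epsilon>\<^sub>0"

end

theory Submission
  imports Defs
begin

text \<open>Write \<open>k(T)\<close> for \<open>sup_norm p T\<close>, \<open>S\<close> for the random set, \<open>L\<close> for the number of its points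
  and \<open>s = N powr \<epsilon>\<^sub>1\<close>.

  The majorant is large for every choice of the points. It is at least \<open>sqrt L\<close>, by comparison with
  the \<open>L\<^sup>2\<close> norm, and its \<open>p\<close>-th power is at least a constant times \<open>L powr (p - 1) / s\<close>: within
  distance about \<open>1 / (a * L)\<close> to the right of a fraction \<open>k / a\<close> with \<open>k\<close> at most \<open>a / (32 * s)\<close>,
  neither the progression nor the perturbation turns the summands away from a common direction.
  It therefore suffices that, outside an event of probability at most \<open>L * exp (- (L powr (1/3)))\<close>,
  \<open>k(S)\<close> is at most \<open>Y * sqrt L\<close>, where \<open>Y powr p\<close> is a constant times the maximum of \<open>1\<close> and
  \<open>L powr (p/2 - 1) / s\<close>. The event is so rare that the trivial bound \<open>k(S) \<le> L\<close> is good enough on it.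

  Suppose that \<open>k(S) > Y * sqrt L\<close>. Choose \<open>T \<subseteq> S\<close> maximizing \<open>k(T) / card T powr (1/4)\<close>, put
  \<open>B = card T\<close>, and let \<open>F\<close> be a nearly extremal sum over \<open>T\<close>. By Maurey's empirical method
  \<open>F / (2 * B)\<close> is within \<open>O(1 / sqrt m)\<close> in \<open>L\<^sup>p\<close> of an average \<open>q\<close> of \<open>m\<close> characters, each
  multiplied by a fourth root of unity. As \<open>k(T)\<close> is much larger than \<open>sqrt B\<close>, a number \<open>m\<close> far
  below \<open>B\<close> suffices. Let the spectrum of \<open>q\<close> be the set of frequencies at which the dual function
  \<open>q * norm q powr (p - 2)\<close> has a large Fourier coefficient. Two facts about it collide:

  \<^item> Pairing \<open>F\<close> with the dual function shows that the points of \<open>T\<close> in the spectrum still support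
    a sum of norm at least \<open>k(T) / 5\<close>, and by the maximality of \<open>T\<close> there are at least \<open>B / 625\<close>
    such points (lemmas \<open>sup_norm_Int_spectrum_ge\<close> and \<open>large_sup_norm_imp_structured\<close>).

  \<^item> By Bessel's inequality the spectrum has at most \<open>4 / Lp_norm p q powr p\<close> elements, which is at
    most \<open>\<rho> * s * B\<close> for a tiny constant \<open>\<rho>\<close> (lemmas \<open>card_spectrum_le\<close> and \<open>spectrum_density\<close>).
    So the expected number of points of \<open>S\<close> in a fixed set of this size is at most \<open>\<rho> * B\<close>.

  The average \<open>q\<close> depends on at most \<open>m \<le> B / 1250\<close> of the random points, and the other points are
  independent of it. Given \<open>q\<close>, Chernoff's bound makes \<open>B / 1250\<close> hits among the others as
  unlikely as \<open>exp (- 10 * B)\<close>, and there are at most \<open>exp (9 * B)\<close> patterns of \<open>m\<close> samples to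
  consider (lemmas \<open>Chernoff_decoupled\<close>, \<open>card_sample_multiplicities_le\<close> and
  \<open>sup_norm_le_outside_rare_event\<close>).

  The exponent \<open>1/4\<close> could be any number strictly between \<open>0\<close> and \<open>1/2\<close>. Being below \<open>1/2\<close>, it makes
  \<open>m / B\<close> decay like a power of \<open>B / L\<close>, so that the entropy \<open>m * ln (L / B)\<close> of the choice of the
  samples stays below a multiple of \<open>B\<close>, without a logarithmic loss; and together with \<open>k(T) \<le> B\<close>
  it forces \<open>B\<close> to be at least a power of \<open>L\<close>, here \<open>L powr (1/3)\<close>, so that the exceptional probabilities sum to little.\<close>

section \<open>Norms of continuous functions on the unit interval\<close>

abbreviation unit_interval :: "real measure" where
  "unit_interval \<equiv> restrict_space lborel {0..1}"

lemma prob_space_unit_interval: "prob_space unit_interval"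
  by (rule prob_spaceI) (simp add: emeasure_restrict_space)

interpretation unit_interval: prob_space unit_interval
  by (rule prob_space_unit_interval)

lemma measure_unit_interval [simp]: "measure unit_interval {0..1} = 1"
  using unit_interval.prob_space by simp

lemma integrable_continuous_unit_interval:
  fixes f :: "real \<Rightarrow> 'a::{banach, second_countable_topology}"
  assumes "continuous_on UNIV f"
  shows "integrable unit_interval f"
proof -
  have "set_integrable lborel {0..1} f"
    by (rule borel_integrable_atLeastAtMost') (rule continuous_on_subset[OF assms], simp)
  then show ?thesis
    by (subst integrable_restrict_space) (auto simp: set_integrable_def)
qed

lemma Lp_norm_eq:
  "Lp_norm p f = (\<integral>x. norm (f x) powr p \<partial>unit_interval) powr (1 / p)"
  unfolding Lp_norm_def set_lebesgue_integral_def
  by (subst integral_restrict_space) auto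

lemma Lp_norm_nonneg: "0 \<le> Lp_norm p f"
  by (simp add: Lp_norm_def)

lemma Lp_norm_powr:
  assumes "p > 0"
  shows "Lp_norm p f powr p = (\<integral>x. norm (f x) powr p \<partial>unit_interval)"
  using assms by (simp add: Lp_norm_eq powr_powr)

lemma Lp_norm_le_iff:
  assumes "p > 0" "A \<ge> 0"
  shows "Lp_norm p f \<le> A \<longleftrightarrow> (\<integral>x. norm (f x) powr p \<partial>unit_interval) \<le> A powr p"
proof -
  have "Lp_norm p f \<le> A \<longleftrightarrow> Lp_norm p f powr p \<le> A powr p"
    using assms Lp_norm_nonneg[of p f]
    by (metis linorder_not_le powr_less_mono2 powr_mono2 less_imp_le)
  then show ?thesis using assms by (simp add: Lp_norm_powr)
qed

lemma continuous_powr_norm: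
  assumes "continuous_on UNIV f" "p > 0"
  shows "continuous_on UNIV (\<lambda>x. norm (f x) powr p)"
  using assms by (intro continuous_on_powr' continuous_intros) auto

text \<open>Hoelder's inequality for the exponents \<open>p\<close> and \<open>p / (p - 1)\<close>, with the second factor written as a
  power so that the conjugate exponent disappears. This form also yields the triangle inequality.\<close>
lemma Hoelder_continuous:
  fixes f h :: "real \<Rightarrow> complex"
  assumes p: "p > 1" and cf: "continuous_on UNIV f" and ch: "continuous_on UNIV h"
  shows "(\<integral>x. norm (f x) * norm (h x) powr (p - 1) \<partial>unit_interval)
           \<le> Lp_norm p f * Lp_norm p h powr (p - 1)" (is "?I \<le> _")
proof -
  have if': "integrable unit_interval (\<lambda>x. norm (f x) powr p)"
   and ih: "integrable unit_interval (\<lambda>x. norm (h x) powr p)"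
   and ifh: "integrable unit_interval (\<lambda>x. norm (f x) * norm (h x) powr (p - 1))"
    using p by (intro integrable_continuous_unit_interval continuous_powr_norm continuous_intros cf ch; simp)+
  \<comment> \<open>Numbers strictly above the norms can be divided by, even if a norm vanishes.\<close>
  have *: "?I \<le> A * B powr (p - 1)" if A: "A > Lp_norm p f" and B: "B > Lp_norm p h" for A B
  proof -
    have A0: "A > 0" and B0: "B > 0" using A B Lp_norm_nonneg[of p f] Lp_norm_nonneg[of p h] by auto
    have pt: "norm (f x) * norm (h x) powr (p - 1)
        \<le> A * B powr (p - 1) * ((norm (f x) powr p / A powr p) / p + (1 - 1/p) * (norm (h x) powr p / B powr p))" for x
    proof -
      have "(norm (f x) / A) * ((norm (h x) / B) powr (p - 1))
          \<le> (norm (f x) / A) powr p / p + ((norm (h x) / B) powr (p - 1)) powr (p / (p - 1)) / (p / (p - 1))"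
        using p A0 B0 by (intro Youngs_inequality) (auto simp: field_simps)
      also have "((norm (h x) / B) powr (p - 1)) powr (p / (p - 1)) = (norm (h x) / B) powr p"
        using p by (simp add: powr_powr)
      finally show ?thesis using p A0 B0 by (simp add: powr_divide field_simps)
    qed
    have "?I \<le> (\<integral>x. A * B powr (p - 1) * ((norm (f x) powr p / A powr p) / p + (1 - 1/p) * (norm (h x) powr p / B powr p)) \<partial>unit_interval)"
      using pt by (intro integral_mono ifh) (auto intro!: if' ih Bochner_Integration.integrable_add)
    also have "\<dots> = A * B powr (p - 1) * (Lp_norm p f powr p / A powr p / p + (1 - 1/p) * (Lp_norm p h powr p / B powr p))"
      using if' ih p by (simp add: Lp_norm_powr)
    also have "\<dots> \<le> A * B powr (p - 1) * (1 / p + (1 - 1/p) * 1)"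
    proof (intro mult_left_mono add_mono divide_right_mono)
      show "Lp_norm p f powr p / A powr p \<le> 1" "Lp_norm p h powr p / B powr p \<le> 1"
        using A B A0 B0 p Lp_norm_nonneg[of p f] Lp_norm_nonneg[of p h] by (auto intro!: powr_mono2)
    qed (use p A0 in auto)
    finally show ?thesis by simp
  qed
  have 1: "((\<lambda>t. (Lp_norm p f + t) * (Lp_norm p h + t) powr (p - 1)) \<longlongrightarrow> (Lp_norm p f + 0) * (Lp_norm p h + 0) powr (p - 1)) (at_right 0)"
    using p Lp_norm_nonneg[of p h]
    by (intro tendsto_intros tendsto_powr') (auto simp: eventually_at_filter)
  have 2: "eventually (\<lambda>t. ?I \<le> (Lp_norm p f + t) * (Lp_norm p h + t) powr (p - 1)) (at_right 0)"
    by (auto simp: eventually_at_filter intro!: always_eventually *)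
  show ?thesis
    using tendsto_lowerbound[OF 1 2] by simp
qed

lemma Lp_norm_triangle:
  fixes f h :: "real \<Rightarrow> complex"
  assumes p: "p > 1" and cf: "continuous_on UNIV f" and ch: "continuous_on UNIV h"
  shows "Lp_norm p (\<lambda>x. f x + h x) \<le> Lp_norm p f + Lp_norm p h"
proof -
  let ?g = "\<lambda>x. f x + h x"
  let ?N = "Lp_norm p ?g"
  have cg: "continuous_on UNIV ?g" by (intro continuous_intros cf ch)
  have i: "integrable unit_interval (\<lambda>x. norm (f x) * norm (?g x) powr (p - 1))"
     "integrable unit_interval (\<lambda>x. norm (h x) * norm (?g x) powr (p - 1))"
     "integrable unit_interval (\<lambda>x. norm (?g x) powr p)"
    using p by (intro integrable_continuous_unit_interval continuous_powr_norm continuous_intros cf ch cg; simp)+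
  have pt: "norm (?g x) powr p \<le> norm (f x) * norm (?g x) powr (p - 1) + norm (h x) * norm (?g x) powr (p - 1)" for x
  proof -
    have "norm (?g x) powr p = norm (?g x) * norm (?g x) powr (p - 1)"
      using p by (cases "?g x = 0") (auto simp: powr_mult_base)
    also have "\<dots> \<le> (norm (f x) + norm (h x)) * norm (?g x) powr (p - 1)"
      by (intro mult_right_mono norm_triangle_ineq) auto
    finally show ?thesis by (simp add: algebra_simps)
  qed
  have "?N powr p = (\<integral>x. norm (?g x) powr p \<partial>unit_interval)" using p by (simp add: Lp_norm_powr)
  also have "\<dots> \<le> (\<integral>x. norm (f x) * norm (?g x) powr (p - 1) + norm (h x) * norm (?g x) powr (p - 1) \<partial>unit_interval)"
    by (intro integral_mono pt Bochner_Integration.integrable_add i)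
  also have "\<dots> \<le> Lp_norm p f * ?N powr (p - 1) + Lp_norm p h * ?N powr (p - 1)"
    using Hoelder_continuous[OF p cf cg] Hoelder_continuous[OF p ch cg] i by simp
  finally have *: "?N powr p \<le> (Lp_norm p f + Lp_norm p h) * ?N powr (p - 1)" by (simp add: algebra_simps)
  show ?thesis
  proof (cases "?N = 0")
    case True then show ?thesis using Lp_norm_nonneg[of p f] Lp_norm_nonneg[of p h] by simp
  next
    case False
    then have "?N > 0" using Lp_norm_nonneg[of p ?g] by simp
    moreover have "?N powr p = ?N * ?N powr (p - 1)" using \<open>?N > 0\<close> by (simp add: powr_mult_base)
    ultimately show ?thesis using * by simp
  qed
qed

lemma Lp_norm_scale:
  fixes f :: "real \<Rightarrow> complex"
  assumes p: "p > 0"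
  shows "Lp_norm p (\<lambda>x. c * f x) = norm c * Lp_norm p f"
proof -
  have "(\<integral>x. norm (c * f x) powr p \<partial>unit_interval) = norm c powr p * (\<integral>x. norm (f x) powr p \<partial>unit_interval)"
    by (simp add: norm_mult powr_mult)
  then show ?thesis using p by (simp add: Lp_norm_eq powr_mult powr_powr)
qed

lemma Lp_norm_le_bound:
  assumes "p > 0" "A \<ge> 0" "continuous_on UNIV f" "\<And>x. norm (f x) \<le> A"
  shows "Lp_norm p f \<le> A"
proof -
  have "(\<integral>x. norm (f x) powr p \<partial>unit_interval) \<le> (\<integral>x. A powr p \<partial>unit_interval)"
    using assms by (intro integral_mono integrable_continuous_unit_interval continuous_powr_norm powr_mono2) auto
  then show ?thesis using assms by (simp add: Lp_norm_le_iff)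
qed

lemma L2_le_Lp_norm:
  fixes f :: "real \<Rightarrow> complex"
  assumes p: "p > 2" and cf: "continuous_on UNIV f"
  shows "(\<integral>x. (norm (f x))\<^sup>2 \<partial>unit_interval) \<le> (Lp_norm p f)\<^sup>2"
proof -
  have *: "(\<integral>x. (norm (f x))\<^sup>2 \<partial>unit_interval) \<le> A\<^sup>2" if A: "A > Lp_norm p f" for A
  proof -
    have A0: "A > 0" using A Lp_norm_nonneg[of p f] by auto
    have pt: "(norm (f x))\<^sup>2 \<le> A\<^sup>2 * ((norm (f x) powr p / A powr p) / (p/2) + (1 - 2/p))" for x
    proof -
      have "(norm (f x) / A)\<^sup>2 * 1 \<le> ((norm (f x) / A)\<^sup>2) powr (p/2) / (p/2) + 1 powr (p/(p-2)) / (p / (p - 2))"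
        using p A0 by (intro Youngs_inequality) (auto simp: field_simps)
      also have "((norm (f x) / A)\<^sup>2) powr (p/2) = (norm (f x) / A) powr p"
        using p A0 by (cases "f x = 0") (simp_all add: powr_powr flip: powr_numeral)
      finally have "(norm (f x) / A)\<^sup>2 \<le> (norm (f x) / A) powr p / (p/2) + (1 - 2/p)"
        using p by (simp add: field_simps)
      then show ?thesis using p A0 by (simp add: powr_divide power_divide field_simps)
    qed
    have "(\<integral>x. (norm (f x))\<^sup>2 \<partial>unit_interval) \<le> (\<integral>x. A\<^sup>2 * ((norm (f x) powr p / A powr p) / (p/2) + (1 - 2/p)) \<partial>unit_interval)"
      using p by (intro integral_mono pt integrable_continuous_unit_interval continuous_intros continuous_powr_norm cf) (use A0 in auto)
    also have "\<dots> = A\<^sup>2 * (Lp_norm p f powr p / A powr p / (p/2) + (1 - 2/p))"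
      using p integrable_continuous_unit_interval[OF continuous_powr_norm[OF cf, of p]]
      by (simp add: Lp_norm_powr unit_interval.prob_space)
    also have "\<dots> \<le> A\<^sup>2 * (1 / (p/2) + (1 - 2/p))"
      using A A0 p Lp_norm_nonneg[of p f]
      by (intro mult_left_mono add_mono divide_right_mono) (auto intro!: powr_mono2)
    finally show ?thesis using p by simp
  qed
  have 1: "((\<lambda>t. (Lp_norm p f + t)\<^sup>2) \<longlongrightarrow> (Lp_norm p f + 0)\<^sup>2) (at_right 0)"
    by (intro tendsto_intros)
  have 2: "eventually (\<lambda>t. (\<integral>x. (norm (f x))\<^sup>2 \<partial>unit_interval) \<le> (Lp_norm p f + t)\<^sup>2) (at_right 0)"
    by (auto simp: eventually_at_filter intro!: always_eventually *)
  show ?thesis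
    using tendsto_lowerbound[OF 1 2] by simp
qed

section \<open>Fourier coefficients of trigonometric sums\<close>

lemma e_add: "e (x + y) = e x * e y"
  by (simp add: e_def algebra_simps exp_add)

lemma norm_e [simp]: "norm (e x) = 1"
  by (simp add: e_def norm_exp_eq_Re)

lemma cnj_e: "cnj (e x) = e (- x)"
  by (simp add: e_def exp_cnj)

lemma e_of_int [simp]: "e (of_int n) = 1"
  using exp_integer_2pi[of "of_int n"] by (simp add: e_def mult_ac)

lemma continuous_on_e [continuous_intros]:
  "continuous_on A f \<Longrightarrow> continuous_on A (\<lambda>x. e (f x))"
  unfolding e_def by (intro continuous_intros)

lemma continuous_exp_sum: "continuous_on UNIV (exp_sum c S)"
  unfolding exp_sum_def by (intro continuous_intros)

lemma integral_e: "(\<integral>x. e (of_int n * x) \<partial>unit_interval) = (if n = 0 then 1 else 0)"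
proof (cases "n = 0")
  case True
  then show ?thesis by (simp add: e_def)
next
  case False
  let ?F = "\<lambda>x::real. e (of_int n * x) / (2 * complex_of_real pi * \<i> * of_int n)"
  have "((\<lambda>x. e (of_int n * x)) has_integral (?F 1 - ?F 0)) {0..1}"
  proof (rule fundamental_theorem_of_calculus)
    fix x :: real
    assume "x \<in> {0..1}"
    let ?c = "2 * complex_of_real pi * \<i> * of_int n"
    have "((\<lambda>z. exp (?c * z) / ?c) has_field_derivative exp (?c * of_real x)) (at (of_real x))"
      using False by (auto intro!: derivative_eq_intros)
    from has_vector_derivative_real_field[OF this]
    show "(?F has_vector_derivative e (of_int n * x)) (at x within {0..1})"
      by (simp add: e_def mult_ac)
  qed simp
  moreover have "?F 1 - ?F 0 = 0" using e_of_int[of n] e_of_int[of 0] by simp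
  moreover have "((\<lambda>x. e (of_int n * x)) has_integral (\<integral>x. e (of_int n * x) \<partial>unit_interval)) {0..1}"
  proof -
    have "set_integrable lborel {0..1} (\<lambda>x. e (of_int n * x))"
      by (intro borel_integrable_atLeastAtMost' continuous_intros)
    from set_borel_integral_eq_integral[OF this]
    show ?thesis unfolding set_lebesgue_integral_def has_integral_iff
      by (subst integral_restrict_space) auto
  qed
  ultimately show ?thesis using False has_integral_unique by auto
qed

definition fourier_coeff :: "(real \<Rightarrow> complex) \<Rightarrow> int \<Rightarrow> complex" where
  "fourier_coeff G n = (\<integral>x. G x * e (- (of_int n * x)) \<partial>unit_interval)"

lemma integral_mult_cnj_exp_sum:
  assumes G: "continuous_on UNIV G"
  shows "(\<integral>x. G x * cnj (exp_sum c K x) \<partial>unit_interval) = (\<Sum>n\<in>K. cnj (c n) * fourier_coeff G n)"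
proof -
  have "(\<integral>x. G x * cnj (exp_sum c K x) \<partial>unit_interval)
      = (\<integral>x. (\<Sum>n\<in>K. cnj (c n) * (G x * e (- (of_int n * x)))) \<partial>unit_interval)"
    by (simp add: exp_sum_def sum_distrib_left cnj_e mult_ac)
  also have "\<dots> = (\<Sum>n\<in>K. (\<integral>x. cnj (c n) * (G x * e (- (of_int n * x))) \<partial>unit_interval))"
    by (intro Bochner_Integration.integral_sum integrable_continuous_unit_interval continuous_intros G)
  finally show ?thesis by (simp add: fourier_coeff_def)
qed

lemma fourier_coeff_exp_sum:
  assumes "finite K" "n \<in> K"
  shows "fourier_coeff (exp_sum c K) n = c n"
proof -
  have *: "c k * e (of_int k * x) * e (- (of_int n * x)) = c k * e (of_int (k - n) * x)" for k x
    by (simp add: left_diff_distrib mult.assoc flip: e_add)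
  have "fourier_coeff (exp_sum c K) n = (\<integral>x. (\<Sum>k\<in>K. c k * e (of_int (k - n) * x)) \<partial>unit_interval)"
    by (simp only: fourier_coeff_def exp_sum_def sum_distrib_right *)
  also have "\<dots> = (\<Sum>k\<in>K. (\<integral>x. c k * e (of_int (k - n) * x) \<partial>unit_interval))"
    by (intro Bochner_Integration.integral_sum integrable_continuous_unit_interval continuous_intros)
  also have "\<dots> = (\<Sum>k\<in>K. if k = n then c k else 0)"
    by (intro sum.cong) (auto simp: integral_e simp del: of_int_diff)
  finally show ?thesis using assms by simp
qed

lemma Parseval_exp_sum:
  assumes "finite K"
  shows "(\<integral>x. (norm (exp_sum c K x))\<^sup>2 \<partial>unit_interval) = (\<Sum>n\<in>K. (norm (c n))\<^sup>2)"
proof -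
  have "complex_of_real (\<integral>x. (norm (exp_sum c K x))\<^sup>2 \<partial>unit_interval)
      = (\<integral>x. exp_sum c K x * cnj (exp_sum c K x) \<partial>unit_interval)"
    by (simp only: complex_norm_square[symmetric] integral_complex_of_real)
  also have "\<dots> = (\<Sum>n\<in>K. cnj (c n) * c n)"
    using assms by (subst integral_mult_cnj_exp_sum) (auto intro!: continuous_exp_sum sum.cong simp: fourier_coeff_exp_sum)
  also have "\<dots> = complex_of_real (\<Sum>n\<in>K. (norm (c n))\<^sup>2)"
    by (simp add: complex_norm_square mult.commute del: of_real_power)
  finally show ?thesis by (simp only: of_real_eq_iff)
qed

text \<open>The square norm of \<open>G\<close> minus its orthogonal projection to the frequencies \<open>K\<close> is nonnegative.\<close>
lemma Bessel_inequality:
  assumes K: "finite K" and G: "continuous_on UNIV G"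
  shows "(\<Sum>n\<in>K. (norm (fourier_coeff G n))\<^sup>2) \<le> (\<integral>x. (norm (G x))\<^sup>2 \<partial>unit_interval)"
proof -
  define P where "P = exp_sum (fourier_coeff G) K"
  define s where "s = (\<Sum>n\<in>K. (norm (fourier_coeff G n))\<^sup>2)"
  have cP: "continuous_on UNIV P" unfolding P_def by (rule continuous_exp_sum)
  have "(\<integral>x. G x * cnj (P x) \<partial>unit_interval) = (\<Sum>n\<in>K. cnj (fourier_coeff G n) * fourier_coeff G n)"
    unfolding P_def by (rule integral_mult_cnj_exp_sum[OF G])
  also have "\<dots> = of_real s" by (simp add: s_def complex_norm_square mult.commute del: of_real_power)
  finally have GP: "(\<integral>x. G x * cnj (P x) \<partial>unit_interval) = of_real s" .
  have iGP: "integrable unit_interval (\<lambda>x. G x * cnj (P x))"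
    by (intro integrable_continuous_unit_interval continuous_intros G cP)
  have "0 \<le> (\<integral>x. (norm (G x - P x))\<^sup>2 \<partial>unit_interval)" by simp
  also have "\<dots> = (\<integral>x. (norm (G x))\<^sup>2 - 2 * Re (G x * cnj (P x)) + (norm (P x))\<^sup>2 \<partial>unit_interval)"
    by (intro Bochner_Integration.integral_cong refl) (simp only: cmod_power2, simp add: power2_eq_square algebra_simps)
  also have "\<dots> = (\<integral>x. (norm (G x))\<^sup>2 \<partial>unit_interval) - 2 * (\<integral>x. Re (G x * cnj (P x)) \<partial>unit_interval) + (\<integral>x. (norm (P x))\<^sup>2 \<partial>unit_interval)"
  proof -
    have "integrable unit_interval (\<lambda>x. (norm (G x))\<^sup>2)" "integrable unit_interval (\<lambda>x. (norm (P x))\<^sup>2)"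
      "integrable unit_interval (\<lambda>x. Re (G x * cnj (P x)))"
      by (intro integrable_continuous_unit_interval continuous_intros G cP)+
    then show ?thesis by (simp del: times_complex.sel)
  qed
  also have "(\<integral>x. Re (G x * cnj (P x)) \<partial>unit_interval) = s"
    using iGP GP by (subst integral_Re) auto
  also have "(\<integral>x. (norm (P x))\<^sup>2 \<partial>unit_interval) = s"
    using Parseval_exp_sum[OF K] by (simp add: P_def s_def)
  finally show ?thesis by (simp add: s_def)
qed

section \<open>The supremum over bounded coefficients\<close>

lemma norm_exp_sum_le:
  assumes "\<And>n. norm (c n) \<le> 1"
  shows "norm (exp_sum c S x) \<le> card S"
proof -
  have "norm (exp_sum c S x) \<le> (\<Sum>n\<in>S. norm (c n * e (of_int n * x)))"
    unfolding exp_sum_def by (rule norm_sum)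
  also have "\<dots> \<le> (\<Sum>n\<in>S. 1)" using assms by (intro sum_mono) (auto simp: norm_mult)
  finally show ?thesis by simp
qed

lemma Lp_norm_exp_sum_le_card:
  assumes "p > 0" "\<And>n. norm (c n) \<le> 1"
  shows "Lp_norm p (exp_sum c S) \<le> card S"
  using assms by (intro Lp_norm_le_bound norm_exp_sum_le continuous_exp_sum) auto

lemma bdd_above_Lp_norms:
  assumes "p > 0"
  shows "bdd_above ((\<lambda>c. Lp_norm p (exp_sum c S)) ` {c. \<forall>n. norm (c n) \<le> 1})"
  using Lp_norm_exp_sum_le_card[OF assms] by (intro bdd_aboveI2[where M = "real (card S)"]) auto

lemma Lp_norm_le_sup_norm:
  assumes "p > 0" "\<And>n. norm (c n) \<le> 1"
  shows "Lp_norm p (exp_sum c S) \<le> sup_norm p S"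
  unfolding sup_norm_def using assms by (intro cSUP_upper bdd_above_Lp_norms) auto

lemma sup_norm_le_card:
  assumes "p > 0"
  shows "sup_norm p S \<le> card S"
  unfolding sup_norm_def
  using assms by (intro cSUP_least) (auto intro!: Lp_norm_exp_sum_le_card exI[of _ "\<lambda>_. 0"])

lemma sup_norm_almost_attained:
  assumes "t < sup_norm p S"
  obtains c where "\<And>n. norm (c n) \<le> 1" "t < Lp_norm p (exp_sum c S)"
proof -
  have "\<exists>y\<in>(\<lambda>c. Lp_norm p (exp_sum c S)) ` {c. \<forall>n. norm (c n) \<le> 1}. t < y"
    using assms unfolding sup_norm_def
    by (intro less_cSupD) (auto intro!: exI[of _ "\<lambda>_. 0"])
  then show ?thesis using that by auto
qed

section \<open>The dual function and its spectrum\<close>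

text \<open>The extremal function for \<open>q\<close> in the duality of \<open>L\<^sup>p\<close>: its pairing with \<open>q\<close> is
  \<open>Lp_norm p q powr p\<close>.\<close>
definition dual_fun :: "real \<Rightarrow> (real \<Rightarrow> complex) \<Rightarrow> real \<Rightarrow> complex" where
  "dual_fun p q x = q x * of_real (norm (q x) powr (p - 2))"

lemma norm_dual_fun: "p > 2 \<Longrightarrow> norm (dual_fun p q x) = norm (q x) powr (p - 1)"
  by (cases "q x = 0") (auto simp: dual_fun_def norm_mult powr_mult_base)

lemma continuous_dual_fun:
  assumes "p > 2" "continuous_on UNIV q"
  shows "continuous_on UNIV (dual_fun p q)"
  unfolding dual_fun_def using assms by (intro continuous_intros continuous_powr_norm) auto

text \<open>If \<open>q\<close> is close to an average of characters, then the average of the corresponding Fourier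
  coefficients of the dual function, with suitable phases, is about \<open>Lp_norm p q powr p\<close>, hence the normalization.\<close>
definition spectrum :: "real \<Rightarrow> (real \<Rightarrow> complex) \<Rightarrow> int set" where
  "spectrum p q = {n. Lp_norm p q powr p / 2 \<le> norm (fourier_coeff (dual_fun p q) n)}"

text \<open>Bessel's inequality bounds the number of large Fourier coefficients of the dual function by its
  square norm, and \<open>norm q \<le> 1\<close> together with \<open>2 * (p - 1) \<ge> p\<close> bounds that by
  \<open>Lp_norm p q powr p\<close>. The finite set \<open>K\<close> replaces the spectrum itself because
  \<open>card\<close> is \<open>0\<close> on infinite sets.\<close>
lemma card_spectrum_le:
  assumes p: "p > 2" and q: "continuous_on UNIV q" and q1: "\<And>x. norm (q x) \<le> 1"
    and pos: "Lp_norm p q > 0" and K: "finite K" "K \<subseteq> spectrum p q"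
  shows "card K * Lp_norm p q powr p \<le> 4"
proof -
  let ?N = "Lp_norm p q powr p"
  have N: "?N > 0" using pos by simp
  have "card K * (?N / 2)\<^sup>2 = (\<Sum>n\<in>K. (?N/2)\<^sup>2)" by simp
  also have "\<dots> \<le> (\<Sum>n\<in>K. (norm (fourier_coeff (dual_fun p q) n))\<^sup>2)"
    using K N by (intro sum_mono power_mono) (auto simp: spectrum_def)
  also have "\<dots> \<le> (\<integral>x. (norm (dual_fun p q x))\<^sup>2 \<partial>unit_interval)"
    by (intro Bessel_inequality K continuous_dual_fun p q)
  also have "\<dots> \<le> (\<integral>x. norm (q x) powr p \<partial>unit_interval)"
  proof (intro integral_mono integrable_continuous_unit_interval continuous_powr_norm continuous_intros continuous_dual_fun p q)
    fix x
    have "(norm (dual_fun p q x))\<^sup>2 = norm (q x) powr ((p - 1) * 2)"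
      using p by (cases "q x = 0") (simp_all add: norm_dual_fun powr_powr flip: powr_numeral)
    also have "\<dots> \<le> norm (q x) powr p" using p q1[of x] by (intro powr_mono') auto
    finally show "(norm (dual_fun p q x))\<^sup>2 \<le> norm (q x) powr p" .
  qed (use p in auto)
  also have "\<dots> = ?N" using p by (simp add: Lp_norm_powr)
  finally have "(card K * ?N) * ?N \<le> 4 * ?N" by (simp add: power2_eq_square field_simps)
  then show ?thesis using N by (simp add: mult_le_cancel_right)
qed

text \<open>With suitable unimodular coefficients on \<open>T\<close>, the sum on the left is the pairing of the dual
  function with a trigonometric sum over \<open>T\<close>, and Hoelder's inequality applies.\<close>
lemma sum_fourier_coeff_dual_le:
  assumes p: "p > 2" and q: "continuous_on UNIV q"
  shows "(\<Sum>n\<in>T. norm (fourier_coeff (dual_fun p q) n)) \<le> sup_norm p T * Lp_norm p q powr (p - 1)"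
proof -
  let ?G = "dual_fun p q"
  define c where "c n = sgn (fourier_coeff ?G n)" for n
  have c1: "norm (c n) \<le> 1" for n by (simp add: c_def norm_sgn)
  have cc: "cnj (c n) * fourier_coeff ?G n = of_real (norm (fourier_coeff ?G n))" for n
  proof (cases "fourier_coeff ?G n = 0")
    case False
    have "cnj (c n) * fourier_coeff ?G n = (fourier_coeff ?G n * cnj (fourier_coeff ?G n)) / norm (fourier_coeff ?G n)"
      by (simp add: c_def sgn_eq)
    also have "\<dots> = of_real ((norm (fourier_coeff ?G n))\<^sup>2) / complex_of_real (norm (fourier_coeff ?G n))"
      by (simp only: complex_norm_square)
    finally show ?thesis using False by (simp add: power2_eq_square)
  qed (simp add: c_def)
  have "complex_of_real (\<Sum>n\<in>T. norm (fourier_coeff ?G n)) = (\<integral>x. ?G x * cnj (exp_sum c T x) \<partial>unit_interval)"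
    using p q by (subst integral_mult_cnj_exp_sum) (auto simp: cc intro: continuous_dual_fun)
  from arg_cong[OF this, of norm]
  have "(\<Sum>n\<in>T. norm (fourier_coeff ?G n)) = norm (\<integral>x. ?G x * cnj (exp_sum c T x) \<partial>unit_interval)"
    by (subst (asm) norm_of_real) (simp add: sum_nonneg)
  also have "\<dots> \<le> (\<integral>x. norm (?G x * cnj (exp_sum c T x)) \<partial>unit_interval)"
    by (rule integral_norm_bound)
  also have "\<dots> = (\<integral>x. norm (exp_sum c T x) * norm (q x) powr (p - 1) \<partial>unit_interval)"
    using p by (simp add: norm_mult norm_dual_fun mult.commute)
  also have "\<dots> \<le> Lp_norm p (exp_sum c T) * Lp_norm p q powr (p - 1)"
    using p q by (intro Hoelder_continuous continuous_exp_sum) auto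
  also have "\<dots> \<le> sup_norm p T * Lp_norm p q powr (p - 1)"
    using p c1 by (intro mult_right_mono Lp_norm_le_sup_norm) auto
  finally show ?thesis .
qed

text \<open>The normalized sum \<open>f\<close> over \<open>T\<close> is close to \<open>q\<close>, so its pairing with the dual function of \<open>q\<close> is
  at least \<open>3/4\<close> of the pairing of \<open>q\<close> itself. The points of \<open>T\<close> off the spectrum contribute at
  most \<open>1/4\<close> by the definition of the spectrum. What the points in the spectrum contribute is
  controlled by the supremum over these points alone.\<close>
lemma sup_norm_Int_spectrum_ge:
  assumes p: "p > 2" and q: "continuous_on UNIV q"
    and T: "finite T" "T \<noteq> {}" and c: "\<And>n. norm (c n) \<le> 1"
    and D: "Lp_norm p (\<lambda>x. exp_sum c T x / (2 * card T) - q x) \<le> Lp_norm p q / 4"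
    and pos: "Lp_norm p q > 0"
  shows "card T * Lp_norm p q \<le> sup_norm p (T \<inter> spectrum p q)"
proof -
  let ?G = "dual_fun p q"
  let ?B = "real (card T)"
  let ?f = "\<lambda>x. exp_sum c T x / (2 * card T)"
  let ?N = "Lp_norm p q"
  let ?a = "\<lambda>n. norm (fourier_coeff ?G n)"
  have B: "?B > 0" using T by (simp add: card_gt_0_iff)
  have cG: "continuous_on UNIV ?G" by (intro continuous_dual_fun p q)
  have cf: "continuous_on UNIV ?f" using B by (intro continuous_intros continuous_exp_sum) auto
  have NN: "?N powr p = ?N * ?N powr (p - 1)" using pos by (simp add: powr_mult_base)
  have int_q: "(\<integral>x. ?G x * cnj (q x) \<partial>unit_interval) = of_real (?N powr p)"
  proof -
    have "?G x * cnj (q x) = of_real (norm (q x) powr p)" for x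
    proof -
      have "?G x * cnj (q x) = of_real ((norm (q x))\<^sup>2 * norm (q x) powr (p - 2))"
        by (simp add: dual_fun_def complex_norm_square mult_ac del: of_real_power)
      also have "(norm (q x))\<^sup>2 * norm (q x) powr (p - 2) = norm (q x) powr p"
        using p by (cases "q x = 0") (simp_all flip: powr_numeral powr_add)
      finally show ?thesis .
    qed
    then show ?thesis using p by (simp add: Lp_norm_powr)
  qed
  have ii: "integrable unit_interval (\<lambda>x. ?G x * cnj (q x))" "integrable unit_interval (\<lambda>x. ?G x * cnj (?f x))"
    "integrable unit_interval (\<lambda>x. ?G x * cnj (?f x - q x))"
    by (intro integrable_continuous_unit_interval continuous_intros cG q cf continuous_exp_sum; use B in simp)+
  have "norm (\<integral>x. ?G x * cnj (?f x - q x) \<partial>unit_interval) \<le> (\<integral>x. norm (?G x * cnj (?f x - q x)) \<partial>unit_interval)"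
    by (rule integral_norm_bound)
  also have "\<dots> = (\<integral>x. norm (?f x - q x) * norm (q x) powr (p - 1) \<partial>unit_interval)"
    using p by (simp add: norm_mult norm_dual_fun mult.commute del: complex_cnj_diff complex_cnj_divide)
  also have "\<dots> \<le> Lp_norm p (\<lambda>x. ?f x - q x) * ?N powr (p - 1)"
    using p by (intro Hoelder_continuous continuous_intros cf q) auto
  also have "\<dots> \<le> ?N / 4 * ?N powr (p - 1)" using D by (intro mult_right_mono) auto
  finally have err: "norm (\<integral>x. ?G x * cnj (?f x - q x) \<partial>unit_interval) \<le> ?N powr p / 4" by (simp add: NN)
  have "(\<integral>x. ?G x * cnj (?f x) \<partial>unit_interval) = (\<integral>x. ?G x * cnj (q x) + ?G x * cnj (?f x - q x) \<partial>unit_interval)"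
    by (simp add: algebra_simps)
  also have "\<dots> = of_real (?N powr p) + (\<integral>x. ?G x * cnj (?f x - q x) \<partial>unit_interval)"
    using ii by (subst Bochner_Integration.integral_add) (auto simp: int_q simp del: complex_cnj_diff)
  finally have eq: "(\<integral>x. ?G x * cnj (?f x) \<partial>unit_interval) = of_real (?N powr p) + (\<integral>x. ?G x * cnj (?f x - q x) \<partial>unit_interval)" .
  have "norm (of_real (?N powr p) :: complex) - norm (\<integral>x. ?G x * cnj (?f x - q x) \<partial>unit_interval) \<le> norm (\<integral>x. ?G x * cnj (?f x) \<partial>unit_interval)"
    unfolding eq by (rule norm_diff_ineq)
  then have big: "3/4 * ?N powr p \<le> norm (\<integral>x. ?G x * cnj (?f x) \<partial>unit_interval)" using err by simp
  have "(\<integral>x. ?G x * cnj (?f x) \<partial>unit_interval) = (\<Sum>n\<in>T. cnj (c n) * fourier_coeff ?G n) / (2 * ?B)"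
    using integral_mult_cnj_exp_sum[OF cG, of c T] by simp
  then have "norm (\<integral>x. ?G x * cnj (?f x) \<partial>unit_interval) = norm (\<Sum>n\<in>T. cnj (c n) * fourier_coeff ?G n) / (2 * ?B)"
    by (simp only: norm_divide) simp
  also have "norm (\<Sum>n\<in>T. cnj (c n) * fourier_coeff ?G n) \<le> (\<Sum>n\<in>T. ?a n)"
    using c by (intro order_trans[OF norm_sum] sum_mono) (auto simp: norm_mult intro!: mult_left_le_one_le)
  also have "(\<Sum>n\<in>T. ?a n) = (\<Sum>n\<in>T \<inter> spectrum p q. ?a n) + (\<Sum>n\<in>T - spectrum p q. ?a n)"
    using T by (metis sum.Int_Diff)
  also have "(\<Sum>n\<in>T - spectrum p q. ?a n) \<le> (\<Sum>n\<in>T - spectrum p q. ?N powr p / 2)"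
    by (intro sum_mono) (auto simp: spectrum_def)
  also have "\<dots> \<le> ?B * (?N powr p / 2)" using T by (simp add: card_mono mult_right_mono)
  finally have "norm (\<integral>x. ?G x * cnj (?f x) \<partial>unit_interval) \<le> ((\<Sum>n\<in>T \<inter> spectrum p q. ?a n) + ?B * (?N powr p / 2)) / (2 * ?B)"
    using B by (simp add: divide_right_mono)
  from order_trans[OF big this]
  have "3/4 * ?N powr p \<le> ((\<Sum>n\<in>T \<inter> spectrum p q. ?a n) + ?B * (?N powr p / 2)) / (2 * ?B)" .
  then have "?B * ?N powr p \<le> (\<Sum>n\<in>T \<inter> spectrum p q. ?a n)" using B by (simp add: field_simps)
  also have "\<dots> \<le> sup_norm p (T \<inter> spectrum p q) * ?N powr (p - 1)"
    by (rule sum_fourier_coeff_dual_le[OF p q])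
  finally show ?thesis using pos by (simp add: NN)
qed

section \<open>Empirical sampling\<close>

lemma exp_le_add_exp_square: "exp (u::real) \<le> u + exp (u\<^sup>2)"
proof -
  consider "u \<ge> 1" | "0 \<le> u" "u \<le> 1" | "-1 \<le> u" "u \<le> 0" | "u \<le> -1" by linarith
  then show ?thesis
  proof cases
    case 1
    then have "u \<le> u\<^sup>2" by (simp add: power2_eq_square)
    then have "exp u \<le> exp (u\<^sup>2)" by simp
    then show ?thesis using 1 by linarith
  next
    case 2
    then show ?thesis using exp_bound[of u] exp_ge_add_one_self[of "u\<^sup>2"] by linarith
  next
    case 3
    define v where "v = - u"
    have v: "0 \<le> v" "v \<le> 1" using 3 by (auto simp: v_def)
    have "exp v \<ge> 1 + v + v\<^sup>2 / 2" using v exp_lower_Taylor_quadratic[of v] by simp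
    moreover have "(1 - v + v\<^sup>2) \<ge> 0" using v by (simp add: power2_eq_square)
    ultimately have "(1 - v + v\<^sup>2) * exp v \<ge> (1 - v + v\<^sup>2) * (1 + v + v\<^sup>2 / 2)" by (intro mult_left_mono) auto
    moreover have "(1 - v + v\<^sup>2) * (1 + v + v\<^sup>2 / 2) = 1 + v^2/2 + v^3/2 + v^4/2"
      by (simp add: field_simps power2_eq_square power3_eq_cube power4_eq_xxxx)
    moreover have "1 + v^2/2 + v^3/2 + v^4/2 \<ge> 1" using v by simp
    ultimately have "(1 - v + v\<^sup>2) * exp v \<ge> 1" by linarith
    then have "exp (- v) \<le> 1 - v + v\<^sup>2" by (simp add: exp_minus field_simps)
    then have "exp u \<le> 1 + u + u\<^sup>2" by (simp add: v_def)
    then show ?thesis using exp_ge_add_one_self[of "u\<^sup>2"] by linarith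
  next
    case 4
    then have "exp u \<le> 1" by simp
    moreover have "- u \<le> u\<^sup>2" using 4 by (simp add: power2_eq_square) (metis minus_le_iff mult_left_mono_neg mult_minus1_right mult.commute le_minus_one_simps(1) order_trans)
    ultimately show ?thesis using exp_ge_add_one_self[of "u\<^sup>2"] by linarith
  qed
qed

text \<open>A version of Hoeffding's lemma for finitely supported laws: the preceding inequality is used because
  its linear term averages to zero.\<close>
lemma exp_moment_le:
  fixes w y :: "'a \<Rightarrow> real"
  assumes w: "\<And>x. x \<in> X \<Longrightarrow> 0 \<le> w x" "sum w X = 1"
    and y: "(\<Sum>x\<in>X. w x * y x) = 0" "\<And>x. x \<in> X \<Longrightarrow> \<bar>y x\<bar> \<le> 2"
  shows "(\<Sum>x\<in>X. w x * exp (t * y x)) \<le> exp (4 * t\<^sup>2)"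
proof -
  have "(\<Sum>x\<in>X. w x * exp (t * y x)) \<le> (\<Sum>x\<in>X. w x * (t * y x + exp (4 * t\<^sup>2)))"
  proof (intro sum_mono mult_left_mono w)
    fix x assume x: "x \<in> X"
    have "(y x)\<^sup>2 \<le> 2\<^sup>2" using y(2)[OF x] by (subst abs_le_square_iff[symmetric]) auto
    then have "t\<^sup>2 * (y x)\<^sup>2 \<le> t\<^sup>2 * 4" by (intro mult_left_mono) auto
    then have "(t * y x)\<^sup>2 \<le> 4 * t\<^sup>2" by (simp add: power_mult_distrib mult.commute)
    then have "exp ((t * y x)\<^sup>2) \<le> exp (4 * t\<^sup>2)" by simp
    then show "exp (t * y x) \<le> t * y x + exp (4 * t\<^sup>2)" using exp_le_add_exp_square[of "t * y x"] by linarith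
  qed
  also have "\<dots> = t * (\<Sum>x\<in>X. w x * y x) + exp (4 * t\<^sup>2) * sum w X"
    by (simp add: distrib_left sum.distrib sum_distrib_left sum_distrib_right mult_ac)
  finally show ?thesis using w y by simp
qed

lemma powr_le_exp:
  assumes "p > 0" "(u::real) \<ge> 0"
  shows "u powr p \<le> p powr p * exp u"
proof -
  have "u / p \<le> exp (u / p)" using exp_ge_add_one_self[of "u/p"] by linarith
  then have "(u / p) powr p \<le> exp (u / p) powr p" using assms by (intro powr_mono2) auto
  also have "exp (u / p) powr p = exp u" using assms by (simp add: powr_def)
  finally show ?thesis using assms by (simp add: powr_divide field_simps)
qed

text \<open>The sum over \<open>\<sigma>\<close> is the \<open>p\<close>-th absolute moment of a sum of \<open>m\<close> independent centred variables
  with law \<open>w\<close>. These are bounded by \<open>2\<close>, so the sum is subgaussian at scale \<open>sqrt m\<close>.\<close>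
lemma sample_moment_le:
  fixes w y :: "'a \<Rightarrow> real"
  assumes X: "finite X" and p: "p > 0" and m: "(m::nat) \<ge> 1"
    and w: "\<And>x. x \<in> X \<Longrightarrow> 0 \<le> w x" "sum w X = 1"
    and y: "(\<Sum>x\<in>X. w x * y x) = 0" "\<And>x. x \<in> X \<Longrightarrow> \<bar>y x\<bar> \<le> 2"
  shows "(\<Sum>\<sigma>\<in>PiE {..<m} (\<lambda>_. X). (\<Prod>l<m. w (\<sigma> l)) * \<bar>\<Sum>l<m. y (\<sigma> l)\<bar> powr p)
          \<le> 2 * p powr p * exp 4 * sqrt m powr p"
proof -
  define t where "t = 1 / sqrt m"
  have t: "t > 0" "t\<^sup>2 * m = 1" using m by (auto simp: t_def power_divide)
  let ?P = "PiE {..<m} (\<lambda>_. X)"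
  let ?W = "\<lambda>\<sigma>. \<Prod>l<m. w (\<sigma> l)"
  let ?S = "\<lambda>\<sigma>. \<Sum>l<m. y (\<sigma> l)"
  have W0: "?W \<sigma> \<ge> 0" if "\<sigma> \<in> ?P" for \<sigma> using that w by (intro prod_nonneg) auto
  have mgf: "(\<Sum>\<sigma>\<in>?P. ?W \<sigma> * exp (r * ?S \<sigma>)) \<le> exp 4" if r: "r\<^sup>2 = t\<^sup>2" for r
  proof -
    have "(\<Sum>\<sigma>\<in>?P. ?W \<sigma> * exp (r * ?S \<sigma>)) = (\<Sum>\<sigma>\<in>?P. \<Prod>l<m. w (\<sigma> l) * exp (r * y (\<sigma> l)))"
      by (simp add: prod.distrib sum_distrib_left exp_sum)
    also have "\<dots> = (\<Prod>l<m. \<Sum>x\<in>X. w x * exp (r * y x))"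
      using X by (subst prod_sum_PiE) auto
    also have "\<dots> \<le> (exp (4 * r\<^sup>2)) ^ m"
      using exp_moment_le[OF w y, of r] w by (simp add: power_mono sum_nonneg)
    also have "\<dots> = exp 4" using t r by (simp add: exp_of_nat_mult[symmetric] mult.commute mult.left_commute)
    finally show ?thesis .
  qed
  have pt: "\<bar>?S \<sigma>\<bar> powr p \<le> sqrt m powr p * (p powr p * (exp (t * ?S \<sigma>) + exp (- t * ?S \<sigma>)))" for \<sigma>
  proof -
    have "\<bar>?S \<sigma>\<bar> powr p = sqrt m powr p * \<bar>t * ?S \<sigma>\<bar> powr p"
      using m by (simp add: t_def abs_mult powr_mult[symmetric])
    also have "\<bar>t * ?S \<sigma>\<bar> powr p \<le> p powr p * exp \<bar>t * ?S \<sigma>\<bar>" using p by (intro powr_le_exp) auto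
    also have "exp \<bar>t * ?S \<sigma>\<bar> \<le> exp (t * ?S \<sigma>) + exp (- t * ?S \<sigma>)"
      by (simp add: abs_if)
    finally show ?thesis by (simp add: mult_left_mono)
  qed
  have "(\<Sum>\<sigma>\<in>?P. ?W \<sigma> * \<bar>?S \<sigma>\<bar> powr p) \<le> (\<Sum>\<sigma>\<in>?P. ?W \<sigma> * (sqrt m powr p * (p powr p * (exp (t * ?S \<sigma>) + exp (- t * ?S \<sigma>)))))"
    using W0 pt by (intro sum_mono mult_left_mono) auto
  also have "\<dots> = sqrt m powr p * p powr p * ((\<Sum>\<sigma>\<in>?P. ?W \<sigma> * exp (t * ?S \<sigma>)) + (\<Sum>\<sigma>\<in>?P. ?W \<sigma> * exp (- t * ?S \<sigma>)))"
    by (simp only: sum_distrib_left sum.distrib[symmetric]) (intro sum.cong refl, simp add: algebra_simps)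
  also have "\<dots> \<le> sqrt m powr p * p powr p * (exp 4 + exp 4)"
    using mgf[of t] mgf[of "- t"] by (intro mult_left_mono add_mono) auto
  finally show ?thesis by (simp add: mult_ac)
qed

lemma sample_moment_complex_le:
  fixes w :: "'a \<Rightarrow> real" and z :: "'a \<Rightarrow> complex"
  assumes X: "finite X" and p: "p > 0" and m: "(m::nat) \<ge> 1"
    and w: "\<And>x. x \<in> X \<Longrightarrow> 0 \<le> w x" "sum w X = 1"
    and z: "(\<Sum>x\<in>X. of_real (w x) * z x) = 0" "\<And>x. x \<in> X \<Longrightarrow> norm (z x) \<le> 2"
  shows "(\<Sum>\<sigma>\<in>PiE {..<m} (\<lambda>_. X). (\<Prod>l<m. w (\<sigma> l)) * norm (\<Sum>l<m. z (\<sigma> l)) powr p)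
          \<le> 2 powr p * (4 * p powr p * exp 4) * sqrt m powr p"
proof -
  let ?P = "PiE {..<m} (\<lambda>_. X)"
  let ?W = "\<lambda>\<sigma>. \<Prod>l<m. w (\<sigma> l)"
  have W0: "?W \<sigma> \<ge> 0" if "\<sigma> \<in> ?P" for \<sigma> using that w by (intro prod_nonneg) auto
  have pt: "norm u powr p \<le> 2 powr p * (\<bar>Re u\<bar> powr p + \<bar>Im u\<bar> powr p)" for u
  proof -
    have "norm u powr p \<le> (2 * max \<bar>Re u\<bar> \<bar>Im u\<bar>) powr p"
      using p cmod_le[of u] by (intro powr_mono2) auto
    also have "\<dots> \<le> 2 powr p * (\<bar>Re u\<bar> powr p + \<bar>Im u\<bar> powr p)"
      by (auto simp: powr_mult max_def)
    finally show ?thesis .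
  qed
  have re: "(\<Sum>x\<in>X. w x * Re (z x)) = 0" "(\<Sum>x\<in>X. w x * Im (z x)) = 0"
    using arg_cong[OF z(1), of Re] arg_cong[OF z(1), of Im] by simp_all
  have "(\<Sum>\<sigma>\<in>?P. ?W \<sigma> * norm (\<Sum>l<m. z (\<sigma> l)) powr p)
      \<le> (\<Sum>\<sigma>\<in>?P. ?W \<sigma> * (2 powr p * (\<bar>Re (\<Sum>l<m. z (\<sigma> l))\<bar> powr p + \<bar>Im (\<Sum>l<m. z (\<sigma> l))\<bar> powr p)))"
    using W0 by (intro sum_mono mult_left_mono pt)
  also have "\<dots> = 2 powr p * ((\<Sum>\<sigma>\<in>?P. ?W \<sigma> * \<bar>\<Sum>l<m. Re (z (\<sigma> l))\<bar> powr p) + (\<Sum>\<sigma>\<in>?P. ?W \<sigma> * \<bar>\<Sum>l<m. Im (z (\<sigma> l))\<bar> powr p))"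
    by (simp only: sum_distrib_left sum.distrib[symmetric]) (intro sum.cong refl, simp add: algebra_simps)
  also have "\<dots> \<le> 2 powr p * (2 * p powr p * exp 4 * sqrt m powr p + 2 * p powr p * exp 4 * sqrt m powr p)"
    by (intro mult_left_mono add_mono sample_moment_le X p m w re)
       (auto intro: order_trans[OF abs_Re_le_cmod] order_trans[OF abs_Im_le_cmod] z)
  finally show ?thesis by (simp add: mult_ac)
qed

definition sampling_const :: "real \<Rightarrow> real" where
  "sampling_const p = 2 * (4 * p powr p * exp 4) powr (1 / p)"

text \<open>Maurey's empirical method: a convex combination of bounded functions is approximated by the
  average of \<open>m\<close> independent samples, with the rate \<open>1 / sqrt m\<close>. The moment bound holds
  at each point \<open>t\<close>; after integration over \<open>t\<close>, some sample does at least as well as the mean.\<close>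
lemma sampling_approximation:
  fixes f :: "'a \<Rightarrow> real \<Rightarrow> complex"
  assumes X: "finite X" and p: "p > 0" and m: "(m::nat) \<ge> 1"
    and w: "\<And>x. x \<in> X \<Longrightarrow> 0 \<le> w x" "sum w X = 1"
    and f: "\<And>x. x \<in> X \<Longrightarrow> continuous_on UNIV (f x)" "\<And>x t. x \<in> X \<Longrightarrow> norm (f x t) \<le> 1"
  obtains \<sigma> where "\<sigma> \<in> PiE {..<m} (\<lambda>_. X)"
    "Lp_norm p (\<lambda>t. (\<Sum>x\<in>X. of_real (w x) * f x t) - (\<Sum>l<m. f (\<sigma> l) t) / m) \<le> sampling_const p / sqrt m"
proof -
  let ?P = "PiE {..<m} (\<lambda>_. X)"
  let ?W = "\<lambda>\<sigma>. \<Prod>l<m. w (\<sigma> l)"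
  define g where "g t = (\<Sum>x\<in>X. of_real (w x) * f x t)" for t
  define A where "A = 2 powr p * (4 * p powr p * exp 4) * sqrt m powr p"
  let ?D = "\<lambda>\<sigma> t. \<Sum>l<m. (g t - f (\<sigma> l) t)"
  have finP: "finite ?P" using X by (intro finite_PiE) auto
  have W0: "?W \<sigma> \<ge> 0" if "\<sigma> \<in> ?P" for \<sigma> using that w by (intro prod_nonneg) auto
  have W1: "(\<Sum>\<sigma>\<in>?P. ?W \<sigma>) = 1"
    using prod_sum_PiE[of "{..<m}" "\<lambda>_. X" "\<lambda>_ x. w x"] X w by simp
  have cg: "continuous_on UNIV g" unfolding g_def by (intro continuous_intros f)
  have cD: "continuous_on UNIV (?D \<sigma>)" if "\<sigma> \<in> ?P" for \<sigma>
    using that by (intro continuous_intros cg f) auto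
  have g1: "norm (g t) \<le> 1" for t
  proof -
    have "norm (g t) \<le> (\<Sum>x\<in>X. norm (of_real (w x) * f x t))" unfolding g_def by (rule norm_sum)
    also have "\<dots> \<le> (\<Sum>x\<in>X. w x)" using w f by (intro sum_mono) (auto simp: norm_mult intro: mult_right_le_one_le)
    finally show ?thesis using w by simp
  qed
  have iD: "integrable unit_interval (\<lambda>t. norm (?D \<sigma> t) powr p)" if "\<sigma> \<in> ?P" for \<sigma>
    using p by (intro integrable_continuous_unit_interval continuous_powr_norm cD that)
  have "(\<Sum>\<sigma>\<in>?P. ?W \<sigma> * (\<integral>t. norm (?D \<sigma> t) powr p \<partial>unit_interval))
      = (\<integral>t. (\<Sum>\<sigma>\<in>?P. ?W \<sigma> * norm (?D \<sigma> t) powr p) \<partial>unit_interval)"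
    using iD by (subst Bochner_Integration.integral_sum) auto
  also have "\<dots> \<le> (\<integral>t. A \<partial>unit_interval)"
  proof (intro integral_mono)
    fix t :: real
    show "(\<Sum>\<sigma>\<in>?P. ?W \<sigma> * norm (?D \<sigma> t) powr p) \<le> A"
      unfolding A_def
    proof (rule sample_moment_complex_le[OF X p m w])
      show "(\<Sum>x\<in>X. of_real (w x) * (g t - f x t)) = 0"
        using w(2) by (simp add: right_diff_distrib sum_subtractf g_def flip: sum_distrib_right of_real_sum)
      show "norm (g t - f x t) \<le> 2" if "x \<in> X" for x
        using norm_triangle_ineq4[of "g t" "f x t"] g1[of t] f(2)[OF that, of t] by linarith
    qed auto
  qed (use iD in auto)
  finally have avg: "(\<Sum>\<sigma>\<in>?P. ?W \<sigma> * (\<integral>t. norm (?D \<sigma> t) powr p \<partial>unit_interval)) \<le> A" by simp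
  have "\<exists>\<sigma>\<in>?P. (\<integral>t. norm (?D \<sigma> t) powr p \<partial>unit_interval) \<le> A"
  proof (rule ccontr)
    assume "\<not> ?thesis"
    then have gt: "(\<integral>t. norm (?D \<sigma> t) powr p \<partial>unit_interval) > A" if "\<sigma> \<in> ?P" for \<sigma> using that by (auto simp: not_le)
    have "\<exists>\<sigma>\<in>?P. ?W \<sigma> \<noteq> 0"
    proof (rule ccontr)
      assume "\<not> (\<exists>\<sigma>\<in>?P. ?W \<sigma> \<noteq> 0)"
      then have "(\<Sum>\<sigma>\<in>?P. ?W \<sigma>) = 0" by (intro sum.neutral) blast
      then show False using W1 by simp
    qed
    then obtain \<sigma>0 where s0: "\<sigma>0 \<in> ?P" "?W \<sigma>0 \<noteq> 0" by blast
    then have s1: "?W \<sigma>0 > 0" using W0[OF s0(1)] by linarith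
    have "(\<Sum>\<sigma>\<in>?P. ?W \<sigma> * A) < (\<Sum>\<sigma>\<in>?P. ?W \<sigma> * (\<integral>t. norm (?D \<sigma> t) powr p \<partial>unit_interval))"
    proof (rule sum_strict_mono_ex1[OF finP])
      show "\<forall>\<sigma>\<in>?P. ?W \<sigma> * A \<le> ?W \<sigma> * (\<integral>t. norm (?D \<sigma> t) powr p \<partial>unit_interval)"
        using W0 gt by (blast intro: mult_left_mono less_imp_le)
      show "\<exists>\<sigma>\<in>?P. ?W \<sigma> * A < ?W \<sigma> * (\<integral>t. norm (?D \<sigma> t) powr p \<partial>unit_interval)"
        using s0(1) mult_strict_left_mono[OF gt[OF s0(1)] s1] by blast
    qed
    then show False using avg W1 by (simp flip: sum_distrib_right)
  qed
  then obtain \<sigma> where s: "\<sigma> \<in> ?P" "(\<integral>t. norm (?D \<sigma> t) powr p \<partial>unit_interval) \<le> A" by blast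
  have "A = (sampling_const p * sqrt m) powr p"
    using p m by (simp add: A_def sampling_const_def powr_mult powr_powr)
  moreover have "0 \<le> sampling_const p * sqrt m" by (simp add: sampling_const_def)
  ultimately have LD: "Lp_norm p (?D \<sigma>) \<le> sampling_const p * sqrt m"
    using s p by (subst Lp_norm_le_iff) auto
  have "(\<lambda>t. g t - (\<Sum>l<m. f (\<sigma> l) t) / m) = (\<lambda>t. of_real (1 / m) * ?D \<sigma> t)"
    using m by (auto simp: sum_subtractf field_simps)
  then have "Lp_norm p (\<lambda>t. g t - (\<Sum>l<m. f (\<sigma> l) t) / m) = 1 / m * Lp_norm p (?D \<sigma>)"
    using Lp_norm_scale[OF p, of "of_real (1/m)" "?D \<sigma>"] by (simp add: norm_divide)
  also have "\<dots> \<le> 1 / m * (sampling_const p * sqrt m)" using LD by (intro mult_left_mono) auto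
  also have "\<dots> = sampling_const p / sqrt m" using m by (simp add: field_simps real_sqrt_mult[symmetric])
  finally show ?thesis using that s(1) unfolding g_def by blast
qed

definition sample_poly :: "nat \<Rightarrow> (nat \<Rightarrow> int \<times> nat) \<Rightarrow> real \<Rightarrow> complex" where
  "sample_poly m \<sigma> t = (\<Sum>l<m. \<i> ^ snd (\<sigma> l) * e (of_int (fst (\<sigma> l)) * t)) / of_nat m"

lemma continuous_sample_poly: "continuous_on UNIV (sample_poly m \<sigma>)"
  unfolding sample_poly_def by (cases "m = 0") (auto intro!: continuous_intros)

lemma norm_sample_poly_le: "norm (sample_poly m \<sigma> t) \<le> 1"
proof (cases "m = 0")
  case False
  have "norm (\<Sum>l<m. \<i> ^ snd (\<sigma> l) * e (of_int (fst (\<sigma> l)) * t)) \<le> (\<Sum>l<m. 1)"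
    by (intro order_trans[OF norm_sum] sum_mono) (simp add: norm_mult norm_power)
  then show ?thesis using False by (simp add: sample_poly_def norm_divide)
qed (simp add: sample_poly_def)

text \<open>Half of a complex number \<open>c\<close> of modulus at most \<open>1\<close> is the mean of a random fourth root of unity.
  Sampling these together with the frequencies leaves only finitely many averages, although the
  coefficients of the sampled sum vary in the unit disc. This is where the factor \<open>2\<close> in
  \<open>2 * card T\<close> comes from.\<close>
lemma fourth_root_average:
  fixes c :: complex
  shows "(\<Sum>k<4. of_real (1 + Re (c * cnj (\<i> ^ k))) * \<i> ^ k) = 2 * c"
  by (simp add: numeral_eq_Suc lessThan_Suc complex_eq_iff)

lemma sample_with_large_spectrum:
  assumes p: "p > 2" and T: "finite T" "T \<noteq> {}" and m: "(m::nat) \<ge> 1" and k: "sup_norm p T > 0"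
    and small: "sampling_const p / sqrt m \<le> sup_norm p T / (40 * card T)"
  obtains \<sigma> where "\<sigma> \<in> {..<m} \<rightarrow> T \<times> {..<4}"
    "sup_norm p T / (5 * card T) \<le> Lp_norm p (sample_poly m \<sigma>)"
    "sup_norm p T / 5 \<le> sup_norm p (T \<inter> spectrum p (sample_poly m \<sigma>))"
proof -
  let ?B = "real (card T)" and ?k = "sup_norm p T"
  have B: "?B > 0" using T by (simp add: card_gt_0_iff)
  obtain c where c: "\<And>n. norm (c n) \<le> 1" "?k / 2 < Lp_norm p (exp_sum c T)"
    using sup_norm_almost_attained[of "?k/2" p T] k by auto
  let ?X = "T \<times> {..<4::nat}"
  define w where "w x = (1 + Re (c (fst x) * cnj (\<i> ^ snd x))) / (4 * ?B)" for x :: "int \<times> nat"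
  define f where "f x t = \<i> ^ snd x * e (of_int (fst x) * t)" for x :: "int \<times> nat" and t
  have w0: "0 \<le> w x" for x
  proof -
    have "\<bar>Re (c (fst x) * cnj (\<i> ^ snd x))\<bar> \<le> norm (c (fst x) * cnj (\<i> ^ snd x))" by (rule abs_Re_le_cmod)
    also have "\<dots> \<le> 1" using c(1) by (simp add: norm_mult norm_power)
    finally show ?thesis using B by (simp add: w_def)
  qed
  have w1: "sum w ?X = 1"
  proof -
    have "sum w ?X = (\<Sum>n\<in>T. \<Sum>k<4. w (n, k))" by (simp add: sum.cartesian_product)
    also have "\<dots> = (\<Sum>n\<in>T. 1 / ?B)"
      by (intro sum.cong refl) (use B in \<open>simp add: w_def numeral_eq_Suc lessThan_Suc field_simps\<close>)
    finally show ?thesis using B by simp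
  qed
  have avg: "(\<Sum>x\<in>?X. of_real (w x) * f x t) = exp_sum c T t / (2 * card T)" for t
  proof -
    have "(\<Sum>x\<in>?X. of_real (w x) * f x t) = (\<Sum>n\<in>T. \<Sum>k<4. of_real (w (n, k)) * f (n, k) t)"
      by (simp add: sum.cartesian_product)
    also have "\<dots> = (\<Sum>n\<in>T. (\<Sum>k<4. of_real (1 + Re (c n * cnj (\<i> ^ k))) * \<i> ^ k) * e (of_int n * t) / (4 * of_real ?B))"
      by (intro sum.cong refl) (simp add: w_def f_def sum_distrib_right sum_divide_distrib mult.assoc del: complex_cnj_power)
    also have "\<dots> = (\<Sum>n\<in>T. c n * e (of_int n * t) / (2 * of_real ?B))"
      by (simp only: fourth_root_average) simp
    finally show ?thesis by (simp add: exp_sum_def sum_divide_distrib)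
  qed
  obtain \<sigma> where s: "\<sigma> \<in> PiE {..<m} (\<lambda>_. ?X)"
    "Lp_norm p (\<lambda>t. (\<Sum>x\<in>?X. of_real (w x) * f x t) - (\<Sum>l<m. f (\<sigma> l) t) / m) \<le> sampling_const p / sqrt m"
    by (rule sampling_approximation[of ?X p m w f])
       (use T p m w0 w1 in \<open>auto simp: f_def norm_mult norm_power intro!: continuous_intros\<close>)
  define q where "q = sample_poly m \<sigma>"
  have cq: "continuous_on UNIV q" unfolding q_def by (rule continuous_sample_poly)
  have cf: "continuous_on UNIV (\<lambda>t. exp_sum c T t / (2 * card T))"
    using B by (intro continuous_intros continuous_exp_sum) auto
  have D: "Lp_norm p (\<lambda>t. exp_sum c T t / (2 * card T) - q t) \<le> ?k / (40 * ?B)"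
    using s(2)[unfolded avg] small by (simp add: f_def q_def sample_poly_def[abs_def])
  have "Lp_norm p (\<lambda>t. exp_sum c T t / (2 * card T)) = Lp_norm p (exp_sum c T) / (2 * ?B)"
    using Lp_norm_scale[of p "1 / (2 * card T)" "exp_sum c T"] p by (simp add: norm_divide norm_mult)
  then have "?k / (4 * ?B) \<le> Lp_norm p (\<lambda>t. exp_sum c T t / (2 * card T))"
    using c(2) B by (simp add: field_simps)
  also have "\<dots> \<le> Lp_norm p (\<lambda>t. exp_sum c T t / (2 * card T) - q t) + Lp_norm p q"
    using Lp_norm_triangle[of p "\<lambda>t. exp_sum c T t / (2 * card T) - q t" q] p cf cq
    by (simp add: continuous_on_diff)
  finally have q5: "?k / (5 * ?B) \<le> Lp_norm p q" using D k B by (simp add: field_simps)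
  have q0: "Lp_norm p q > 0" using q5 k B by (smt (verit) divide_pos_pos mult_pos_pos)
  have "?k / (40 * ?B) \<le> Lp_norm p q / 4" using q5 k B by (simp add: field_simps)
  then have "?B * Lp_norm p q \<le> sup_norm p (T \<inter> spectrum p q)"
    using D by (intro sup_norm_Int_spectrum_ge[where c = c, OF p cq T c(1) _ q0]) auto
  moreover have "?k / 5 \<le> ?B * Lp_norm p q" using q5 B by (simp add: field_simps)
  ultimately have "?k / 5 \<le> sup_norm p (T \<inter> spectrum p q)" by linarith
  then show ?thesis using that[of \<sigma>] s(1) q5 by (auto simp: q_def PiE_def)
qed

section \<open>The structure behind a large supremum\<close>

lemma maximal_subset:
  assumes S: "finite S" "S \<noteq> {}"
  obtains T where "T \<subseteq> S" "T \<noteq> {}"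
    "sup_norm p S / card S powr (1/4) \<le> sup_norm p T / card T powr (1/4)"
    "\<And>R. R \<subseteq> T \<Longrightarrow> R \<noteq> {} \<Longrightarrow> sup_norm p R / card R powr (1/4) \<le> sup_norm p T / card T powr (1/4)"
proof -
  let ?h = "\<lambda>T. sup_norm p T / card T powr (1/4)"
  let ?C = "Pow S - {{}}"
  have C: "finite (?h ` ?C)" "?h ` ?C \<noteq> {}" using S by auto
  from Max_in[OF C] obtain T where T: "Max (?h ` ?C) = ?h T" "T \<in> ?C" by (rule imageE)
  have "?h R \<le> ?h T" if "R \<in> ?C" for R unfolding T(1)[symmetric] using that by (intro Max_ge[OF C(1)]) (rule imageI)
  then show ?thesis using that[of T] T(2) S by auto
qed

text \<open>Maurey's method takes about \<open>B\<^sup>2 / k(T)\<^sup>2\<close> samples to approximate an extremal sum over \<open>T\<close>. For a maximal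
  \<open>T\<close>, \<open>k(T)\<close> is at least a large constant times \<open>B powr (1/4) * L powr (1/4)\<close>, so that
  \<open>sqrt (B ^ 3 / L)\<close> samples with a small constant in front are enough. The factor \<open>1/1250\<close>
  keeps this number at most half of \<open>B / 625\<close>.\<close>
definition sample_size :: "nat \<Rightarrow> nat \<Rightarrow> nat" where
  "sample_size B L = nat \<lfloor>sqrt (real B ^ 3 / L) / 1250\<rfloor>"

lemma sample_size_le:
  "real (sample_size B L) \<le> sqrt (real B ^ 3 / L) / 1250"
  unfolding sample_size_def by (intro of_nat_floor) simp

text \<open>The number \<open>36\<close> makes \<open>sample_size\<close> positive for the sizes \<open>B\<close> that occur, since \<open>36\<^sup>2 \<ge> 1250\<close>; the factor \<open>2000\<close> brings the sampling
  error below \<open>k(T) / (40 * B)\<close>.\<close>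
definition threshold :: "real \<Rightarrow> real" where
  "threshold p = max 36 (2000 * sampling_const p)"

lemma sampling_const_nonneg: "0 \<le> sampling_const p"
  by (simp add: sampling_const_def)

text \<open>In the maximal subset \<open>T\<close>, the part inside the spectrum of a sample keeps a fifth of \<open>k(T)\<close>. As
  \<open>k(R) / card R powr (1/4)\<close> cannot exceed its value at \<open>T\<close>, this part has at least
  \<open>(1/5) ^ 4 * card T\<close> elements. The conclusion mentions \<open>T\<close> only through \<open>B = card T\<close>: what remains
  is a finite amount of data, to which a union bound applies.\<close>
lemma large_sup_norm_imp_structured:
  assumes p: "p > 2" and S: "finite S" "S \<noteq> {}" and Y: "threshold p \<le> Y"
    and large: "Y * sqrt (card S) < sup_norm p S"
  obtains B \<sigma> where "1 \<le> B" "B \<le> card S" "card S \<le> B ^ 3" "1 \<le> sample_size B (card S)"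
    "\<sigma> \<in> {..<sample_size B (card S)} \<rightarrow> S \<times> {..<4}"
    "Y / 5 * (card S / real B ^ 3) powr (1/4) \<le> Lp_norm p (sample_poly (sample_size B (card S)) \<sigma>)"
    "real B / 625 \<le> card (S \<inter> spectrum p (sample_poly (sample_size B (card S)) \<sigma>))"
proof -
  define L where "L = card S"
  have L: "L \<ge> 1" using S by (simp add: L_def Suc_le_eq card_gt_0_iff)
  have Y36: "Y \<ge> 36" and Ys: "2000 * sampling_const p \<le> Y" using Y by (auto simp: threshold_def)
  obtain T where T: "T \<subseteq> S" "T \<noteq> {}"
    "sup_norm p S / card S powr (1/4) \<le> sup_norm p T / card T powr (1/4)"
    and Tmax: "\<And>R. R \<subseteq> T \<Longrightarrow> R \<noteq> {} \<Longrightarrow> sup_norm p R / card R powr (1/4) \<le> sup_norm p T / card T powr (1/4)"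
    using maximal_subset[OF S] by metis
  define B where "B = card T"
  define k where "k = sup_norm p T"
  have finT: "finite T" using T(1) S finite_subset by blast
  have B1: "B \<ge> 1" using finT T by (simp add: B_def Suc_le_eq card_gt_0_iff)
  have BL: "B \<le> L" using T S by (simp add: B_def L_def card_mono)
  have "sqrt L = L powr (1/4) * L powr (1/4)" using L by (simp add: powr_half_sqrt[symmetric] flip: powr_add)
  then have "Y * L powr (1/4) = Y * sqrt L / L powr (1/4)" using L by simp
  also have "\<dots> \<le> sup_norm p S / L powr (1/4)" using large by (intro divide_right_mono) (auto simp: L_def)
  also have "\<dots> \<le> k / B powr (1/4)" using T(3) by (simp add: L_def k_def B_def)
  finally have k1: "Y * L powr (1/4) * B powr (1/4) \<le> k" using B1 by (simp add: field_simps)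
  \<comment> \<open>Up to constants, \<open>1 / x\<^sup>2\<close> is the number of samples and \<open>Y * x / 5\<close> bounds the norm of their average from below.\<close>
  define x where "x = (L / real B ^ 3) powr (1/4)"
  have x0: "x > 0" using L B1 by (simp add: x_def)
  have "B powr (1/4) / B = (1 / real B ^ 3) powr (1/4)"
  proof -
    have "B powr (1/4) / B = B powr (1/4) / B powr 1" by simp
    also have "\<dots> = B powr (1/4 - 1)" by (rule powr_diff[symmetric])
    also have "\<dots> = (B powr 3) powr (- 1/4)" by (simp only: powr_powr) simp
    also have "B powr 3 = real B ^ 3" using B1 by (simp add: powr_realpow flip: powr_numeral)
    finally show ?thesis by (simp add: powr_minus_divide powr_divide)
  qed
  then have "L powr (1/4) * B powr (1/4) / B = x" using B1 by (simp add: x_def powr_divide field_simps)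
  then have k2: "Y * x \<le> k / B" using k1 B1 by (simp add: field_simps)
  have k0: "k > 0" using k2 x0 Y36 B1 by (smt (verit) mult_pos_pos zero_less_divide_iff of_nat_0_le_iff)
  have "k \<le> B" unfolding k_def B_def using p by (intro sup_norm_le_card) simp
  then have Yx: "Y * x \<le> 1" using k2 B1 by (smt (verit) divide_le_eq_1 of_nat_0_less_iff less_le_trans zero_less_one)
  have x4: "x ^ 4 = L / real B ^ 3" using L B1 by (simp add: x_def powr_powr flip: powr_numeral)
  have "x ^ 2 = sqrt (L / real B ^ 3)"
    using x4 x0 by (intro real_sqrt_unique[symmetric]) (simp_all flip: power_mult)
  then have sq: "sqrt (real B ^ 3 / L) = 1 / x\<^sup>2" using real_sqrt_divide by (simp add: real_sqrt_divide)
  have "x \<le> 1 / Y" using Yx Y36 by (simp add: field_simps)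
  then have "x \<le> 1 / 36" using Y36 by (smt (verit) frac_le)
  then have "x\<^sup>2 \<le> (1/36)\<^sup>2" using x0 by (intro power_mono) auto
  then have x2: "1250 * x\<^sup>2 \<le> 1" by (simp add: power_divide)
  have LB: "L \<le> B ^ 3"
  proof -
    have "x ^ 4 \<le> 1" using \<open>x \<le> 1/36\<close> x0 by (intro power_le_one) auto
    then have "real L \<le> real (B ^ 3)" using x4 B1 by (simp add: field_simps)
    then show ?thesis by linarith
  qed
  define m where "m = sample_size B L"
  have sq1: "sqrt (real B ^ 3 / L) / 1250 \<ge> 1" using x2 x0 by (simp add: sq field_simps)
  have m1: "m \<ge> 1" using sq1 by (simp add: m_def sample_size_def le_nat_floor)
  have m2: "1 / (2500 * x\<^sup>2) \<le> m"
  proof -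
    have "sqrt (real B ^ 3 / L) / 1250 < m + 1" using sq1 by (simp add: m_def sample_size_def) linarith
    then have "sqrt (real B ^ 3 / L) / 1250 \<le> 2 * m" using m1 by linarith
    then show ?thesis by (simp add: sq)
  qed
  have "1 / (50 * x) \<le> sqrt m"
  proof (rule real_le_rsqrt)
    show "(1 / (50 * x))\<^sup>2 \<le> real m" using m2 by (simp add: power_divide power_mult_distrib)
  qed
  then have sm: "1 / sqrt m \<le> 50 * x" using x0 m1 by (simp add: field_simps)
  have "sampling_const p / sqrt m = sampling_const p * (1 / sqrt m)" by simp
  also have "\<dots> \<le> sampling_const p * (50 * x)" using sm by (intro mult_left_mono sampling_const_nonneg)
  also have "\<dots> \<le> Y / 2000 * (50 * x)" using Ys x0 by (intro mult_right_mono) auto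
  also have "\<dots> \<le> k / (40 * B)" using k2 B1 by (simp add: field_simps)
  finally have small: "sampling_const p / sqrt m \<le> sup_norm p T / (40 * card T)" by (simp add: k_def B_def)
  obtain \<sigma> where s: "\<sigma> \<in> {..<m} \<rightarrow> T \<times> {..<4}"
    "sup_norm p T / (5 * card T) \<le> Lp_norm p (sample_poly m \<sigma>)"
    "sup_norm p T / 5 \<le> sup_norm p (T \<inter> spectrum p (sample_poly m \<sigma>))"
    using sample_with_large_spectrum[OF p finT T(2) m1 _ small] k0 by (auto simp: k_def)
  let ?R = "T \<inter> spectrum p (sample_poly m \<sigma>)"
  have Rne: "?R \<noteq> {}"
  proof
    assume "?R = {}"
    then have "sup_norm p ?R \<le> 0" using sup_norm_le_card[of p "{}"] p by simp
    then show False using s(3) k0 by (simp add: k_def)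
  qed
  have R1: "card ?R \<ge> 1" using finT Rne by (simp add: Suc_le_eq card_gt_0_iff)
  have "k / 5 / card ?R powr (1/4) \<le> sup_norm p ?R / card ?R powr (1/4)"
    using s(3) by (intro divide_right_mono) (auto simp: k_def)
  also have "\<dots> \<le> k / B powr (1/4)" using Tmax[of ?R] Rne by (simp add: k_def B_def)
  finally have "B powr (1/4) \<le> 5 * card ?R powr (1/4)" using k0 R1 B1 by (simp add: field_simps)
  then have "(B powr (1/4)) ^ 4 \<le> (5 * card ?R powr (1/4)) ^ 4" by (intro power_mono) auto
  then have "B \<le> 625 * real (card ?R)"
    using B1 R1 by (simp add: power_mult_distrib powr_powr flip: powr_numeral)
  also have "real (card ?R) \<le> card (S \<inter> spectrum p (sample_poly m \<sigma>))"
    using T(1) S by (intro of_nat_mono card_mono) auto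
  finally have c: "real B / 625 \<le> card (S \<inter> spectrum p (sample_poly m \<sigma>))" by simp
  have q: "Y / 5 * x \<le> Lp_norm p (sample_poly m \<sigma>)"
    using s(2) k2 by (simp add: k_def B_def)
  have "T \<times> {..<4::nat} \<subseteq> S \<times> {..<4}" using T(1) by auto
  then have "\<sigma> \<in> {..<m} \<rightarrow> S \<times> {..<4}" using s(1) by (meson Pi_mono subsetD)
  then show ?thesis
    by (rule that[of B \<sigma>, folded L_def, folded m_def, folded x_def, OF B1 BL LB m1 _ q c])
qed

text \<open>Since \<open>3 * p / 4 - 1\<close> is positive, the bound \<open>4 / Lp_norm p q powr p\<close> is, relative to \<open>B\<close>, worst for
  \<open>B = L\<close>, and there the hypothesis on \<open>Y\<close> is exactly what is needed.\<close>
lemma spectrum_density: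
  fixes s \<rho> Y :: real
  assumes p: "p > 2" and s: "s > 0" and \<rho>: "\<rho> > 0" and Y: "Y > 0" and B: "1 \<le> B" "B \<le> L"
    and YK: "4 * 5 powr p / \<rho> * (real L powr (p/2 - 1) / s) \<le> Y powr p"
    and q: "continuous_on UNIV q" "\<And>x. norm (q x) \<le> 1"
    and big: "Y / 5 * (L / real B ^ 3) powr (1/4) \<le> Lp_norm p q"
    and K: "finite K" "K \<subseteq> spectrum p q"
  shows "card K \<le> \<rho> * s * B"
proof -
  let ?x = "Y / 5 * (L / real B ^ 3) powr (1/4)"
  have L: "L \<ge> 1" using B by simp
  have x0: "?x > 0" using L B Y by simp
  have "?x powr p = Y powr p / 5 powr p * (L / real B ^ 3) powr (p/4)"
    using Y L B by (simp add: powr_mult powr_divide powr_powr)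
  also have "(L / real B ^ 3) powr (p/4) = L powr (p/4) / B powr (3 * p / 4)"
    using B L by (simp add: powr_divide powr_powr flip: powr_numeral)
  finally have xp: "?x powr p = Y powr p / 5 powr p * (L powr (p/4) / B powr (3 * p / 4))" .
  have "4 / \<rho> * (L powr (p/2 - 1) / s) * (L powr (p/4) / B powr (3 * p / 4)) \<le> ?x powr p"
    unfolding xp using YK by (intro mult_right_mono) (auto simp: field_simps)
  also have "?x powr p \<le> Lp_norm p q powr p" using big x0 p by (intro powr_mono2) auto
  finally have lb: "4 / \<rho> * (L powr (p/2 - 1) / s) * (L powr (p/4) / B powr (3 * p / 4)) \<le> Lp_norm p q powr p" .
  have "L powr (p/2 - 1) * L powr (p/4) = L powr (3*p/4 - 1)" by (simp flip: powr_add)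
  moreover have "B powr (3*p/4 - 1) \<le> L powr (3*p/4 - 1)" using B p by (intro powr_mono2) auto
  moreover have "B powr (3*p/4 - 1) = B powr (3*p/4) / B" using B by (simp add: powr_diff)
  ultimately have "B powr (3*p/4) / B \<le> L powr (p/2 - 1) * L powr (p/4)" by simp
  then have "4 / (\<rho> * s * B) \<le> 4 / \<rho> * (L powr (p/2 - 1) / s) * (L powr (p/4) / B powr (3 * p / 4))"
    using B s \<rho> by (simp add: field_simps)
  then have l2: "4 / (\<rho> * s * B) \<le> Lp_norm p q powr p" using lb by linarith
  have "Lp_norm p q > 0" using x0 big by linarith
  from card_spectrum_le[OF p q this K] have "card K * Lp_norm p q powr p \<le> 4" .
  moreover have "card K * (4 / (\<rho> * s * B)) \<le> card K * Lp_norm p q powr p" using l2 by (intro mult_left_mono) auto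
  ultimately have "card K * (4 / (\<rho> * s * B)) \<le> 4" by linarith
  then show ?thesis using \<rho> s B by (simp add: field_simps)
qed

section \<open>Hits of a random set that depends on few of the points\<close>

text \<open>Chernoff's bound with the weight \<open>\<theta>\<close> per hit, carried out on the event that the variables indexed by
  \<open>J'\<close> take prescribed values: the indicator of this event is one more factor in the product of
  functions of independent variables.\<close>
lemma (in prob_space) Chernoff_given_values:
  fixes \<eta> :: "'i \<Rightarrow> 'a \<Rightarrow> 'b"
  assumes J: "finite J" "J' \<subseteq> J" and indep: "indep_vars (\<lambda>_. count_space UNIV) \<eta> J"
    and \<theta>: "\<theta> \<ge> 1" and R: "(\<Sum>j\<in>J - J'. prob {\<omega>\<in>space M. \<eta> j \<omega> \<in> \<Lambda>}) \<le> R"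
  shows "prob {\<omega>\<in>space M. (\<forall>j\<in>J'. \<eta> j \<omega> = \<alpha> j) \<and> r \<le> real (card {j\<in>J - J'. \<eta> j \<omega> \<in> \<Lambda>})}
      \<le> (\<Prod>j\<in>J'. prob {\<omega>\<in>space M. \<eta> j \<omega> = \<alpha> j}) * (\<theta> powr (- r) * exp (\<theta> * R))"
    (is "prob ?A \<le> _")
proof -
  define Y where "Y j n = (if j \<in> J' then (if n = \<alpha> j then 1 else 0) else (if n \<in> \<Lambda> then \<theta> else 1))" for j n
  have Y0: "0 \<le> Y j n" for j n using \<theta> by (simp add: Y_def)
  have meas: "\<eta> j \<in> measurable M (count_space UNIV)" if "j \<in> J" for j
    using indep that by (auto simp: indep_vars_def)
  have ev: "{\<omega>\<in>space M. Q (\<eta> j \<omega>)} \<in> events" if "j \<in> J" for j Q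
    using measurable_sets[OF meas[OF that], of "{n. Q n}"] by (simp add: vimage_def Int_def conj_commute)
  have indepY: "indep_vars (\<lambda>_. borel) (\<lambda>j \<omega>. Y j (\<eta> j \<omega>)) J"
    by (rule indep_vars_compose2[OF indep]) auto
  have mY: "(\<lambda>\<omega>. Y j (\<eta> j \<omega>)) \<in> borel_measurable M" if "j \<in> J" for j
    using meas[OF that] by (rule measurable_compose) simp
  have intY: "integrable M (\<lambda>\<omega>. Y j (\<eta> j \<omega>))" if "j \<in> J" for j
    using \<theta> by (intro integrable_const_bound[of _ "max 1 \<theta>"] mY that) (auto simp: Y_def)
  have EY1: "expectation (\<lambda>\<omega>. Y j (\<eta> j \<omega>)) = prob {\<omega>\<in>space M. \<eta> j \<omega> = \<alpha> j}" if "j \<in> J'" for j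
  proof -
    have "expectation (\<lambda>\<omega>. Y j (\<eta> j \<omega>)) = expectation (indicator {\<omega>\<in>space M. \<eta> j \<omega> = \<alpha> j})"
      using that by (intro Bochner_Integration.integral_cong) (auto simp: Y_def)
    then show ?thesis using ev[of j "\<lambda>n. n = \<alpha> j"] that J by auto
  qed
  have EY2: "expectation (\<lambda>\<omega>. Y j (\<eta> j \<omega>)) \<le> exp (\<theta> * prob {\<omega>\<in>space M. \<eta> j \<omega> \<in> \<Lambda>})" if "j \<in> J - J'" for j
  proof -
    let ?E = "{\<omega>\<in>space M. \<eta> j \<omega> \<in> \<Lambda>}"
    have E: "?E \<in> events" using ev[of j "\<lambda>n. n \<in> \<Lambda>"] that by auto
    have "expectation (\<lambda>\<omega>. Y j (\<eta> j \<omega>)) = expectation (\<lambda>\<omega>. 1 + (\<theta> - 1) * indicator ?E \<omega>)"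
      using that by (intro Bochner_Integration.integral_cong) (auto simp: Y_def indicator_def)
    also have "\<dots> = 1 + (\<theta> - 1) * prob ?E"
    proof -
      have "integrable M (indicat_real ?E)" using E by (intro integrable_real_indicator) (auto simp: emeasure_eq_measure)
      moreover have "expectation (indicat_real ?E) = prob ?E" using E by (simp add: Int_absorb2)
      ultimately show ?thesis by (simp only: Bochner_Integration.integral_add integrable_const integrable_mult_right integral_mult_right) (simp add: prob_space)
    qed
    also have "\<dots> \<le> 1 + \<theta> * prob ?E" by (simp add: algebra_simps)
    also have "\<dots> \<le> exp (\<theta> * prob ?E)" by (rule exp_ge_add_one_self)
    finally show ?thesis .
  qed
  have fin: "finite J'" "finite (J - J')" using J finite_subset by auto
  have split: "(\<Prod>j\<in>J. f j) = (\<Prod>j\<in>J'. f j) * (\<Prod>j\<in>J - J'. f j)" for f :: "'i \<Rightarrow> real"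
    using prod.subset_diff[OF J(2) J(1), of f] by (simp add: mult.commute)
  have pt: "indicator ?A \<omega> \<le> \<theta> powr (- r) * (\<Prod>j\<in>J. Y j (\<eta> j \<omega>))" for \<omega>
  proof (cases "\<omega> \<in> ?A")
    case True
    then have a: "\<forall>j\<in>J'. \<eta> j \<omega> = \<alpha> j" and c: "r \<le> real (card {j\<in>J - J'. \<eta> j \<omega> \<in> \<Lambda>})" by auto
    have "(\<Prod>j\<in>J. Y j (\<eta> j \<omega>)) = (\<Prod>j\<in>J - J'. if \<eta> j \<omega> \<in> \<Lambda> then \<theta> else 1)"
      unfolding split using a by (simp add: Y_def)
    also have "\<dots> = \<theta> ^ card {j\<in>J - J'. \<eta> j \<omega> \<in> \<Lambda>}"
      using fin by (simp add: prod.If_cases Int_def)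
    also have "\<dots> = \<theta> powr real (card {j\<in>J - J'. \<eta> j \<omega> \<in> \<Lambda>})" using \<theta> by (simp add: powr_realpow)
    also have "\<dots> \<ge> \<theta> powr r" using c \<theta> by (intro powr_mono) auto
    finally have "\<theta> powr (- r) * \<theta> powr r \<le> \<theta> powr (- r) * (\<Prod>j\<in>J. Y j (\<eta> j \<omega>))" by (intro mult_left_mono) auto
    then show ?thesis using True \<theta> by (simp flip: powr_add)
  qed (auto intro!: mult_nonneg_nonneg prod_nonneg Y0)
  have iP: "integrable M (\<lambda>\<omega>. \<Prod>j\<in>J. Y j (\<eta> j \<omega>))"
    by (rule indep_vars_integrable[OF J(1) indepY intY])
  have "(\<Prod>j\<in>J. expectation (\<lambda>\<omega>. Y j (\<eta> j \<omega>)))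
     = (\<Prod>j\<in>J'. prob {\<omega>\<in>space M. \<eta> j \<omega> = \<alpha> j}) * (\<Prod>j\<in>J - J'. expectation (\<lambda>\<omega>. Y j (\<eta> j \<omega>)))"
    by (simp add: split EY1)
  also have "\<dots> \<le> (\<Prod>j\<in>J'. prob {\<omega>\<in>space M. \<eta> j \<omega> = \<alpha> j}) * exp (\<theta> * R)"
  proof (intro mult_left_mono prod_nonneg)
    have "(\<Prod>j\<in>J - J'. expectation (\<lambda>\<omega>. Y j (\<eta> j \<omega>))) \<le> (\<Prod>j\<in>J - J'. exp (\<theta> * prob {\<omega>\<in>space M. \<eta> j \<omega> \<in> \<Lambda>}))"
      using EY2 Y0 by (intro prod_mono) auto
    also have "\<dots> = exp (\<theta> * (\<Sum>j\<in>J - J'. prob {\<omega>\<in>space M. \<eta> j \<omega> \<in> \<Lambda>}))"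
      using fin by (simp add: exp_sum sum_distrib_left)
    also have "\<dots> \<le> exp (\<theta> * R)" using R \<theta> by simp
    finally show "(\<Prod>j\<in>J - J'. expectation (\<lambda>\<omega>. Y j (\<eta> j \<omega>))) \<le> exp (\<theta> * R)" .
  qed auto
  finally have prodE: "(\<Prod>j\<in>J. expectation (\<lambda>\<omega>. Y j (\<eta> j \<omega>)))
     \<le> (\<Prod>j\<in>J'. prob {\<omega>\<in>space M. \<eta> j \<omega> = \<alpha> j}) * exp (\<theta> * R)" .
  have "prob ?A = expectation (\<lambda>\<omega>. indicator ?A \<omega>)" by (simp add: Int_absorb2)
  also have "\<dots> \<le> expectation (\<lambda>\<omega>. \<theta> powr (- r) * (\<Prod>j\<in>J. Y j (\<eta> j \<omega>)))"
    using iP by (intro integral_mono' pt) (auto intro!: mult_nonneg_nonneg prod_nonneg Y0)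
  also have "\<dots> = \<theta> powr (- r) * (\<Prod>j\<in>J. expectation (\<lambda>\<omega>. Y j (\<eta> j \<omega>)))"
    using indep_vars_lebesgue_integral[OF J(1) indepY intY] by simp
  also have "\<dots> \<le> \<theta> powr (- r) * ((\<Prod>j\<in>J'. prob {\<omega>\<in>space M. \<eta> j \<omega> = \<alpha> j}) * exp (\<theta> * R))"
    by (intro mult_left_mono prodE) auto
  finally show ?thesis by (simp add: mult_ac)
qed

text \<open>The target set \<open>\<Lambda> \<alpha>\<close> may depend on the values \<open>\<alpha>\<close> of the variables indexed by \<open>J'\<close>. Splitting
  according to these values reduces to fixed targets, and costs nothing because their
  probabilities add up to at most \<open>1\<close>.\<close>
lemma (in prob_space) Chernoff_decoupled:
  fixes \<eta> :: "'i \<Rightarrow> 'a \<Rightarrow> 'b"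
  assumes J: "finite J" "J' \<subseteq> J" and indep: "indep_vars (\<lambda>_. count_space UNIV) \<eta> J"
    and I: "\<And>j. j \<in> J \<Longrightarrow> finite (I j)" "\<And>j. j \<in> J \<Longrightarrow> AE \<omega> in M. \<eta> j \<omega> \<in> I j"
    and \<theta>: "\<theta> \<ge> 1"
    and R: "\<And>\<alpha>. \<alpha> \<in> PiE J' I \<Longrightarrow> (\<Sum>j\<in>J - J'. prob {\<omega>\<in>space M. \<eta> j \<omega> \<in> \<Lambda> \<alpha>}) \<le> R"
  shows "prob {\<omega>\<in>space M. \<exists>\<alpha>\<in>PiE J' I. (\<forall>j\<in>J'. \<eta> j \<omega> = \<alpha> j) \<and> r \<le> real (card {j\<in>J - J'. \<eta> j \<omega> \<in> \<Lambda> \<alpha>})}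
      \<le> \<theta> powr (- r) * exp (\<theta> * R)"
    (is "prob ?A \<le> _")
  and "{\<omega>\<in>space M. \<exists>\<alpha>\<in>PiE J' I. (\<forall>j\<in>J'. \<eta> j \<omega> = \<alpha> j) \<and> r \<le> real (card {j\<in>J - J'. \<eta> j \<omega> \<in> \<Lambda> \<alpha>})} \<in> events"
proof -
  let ?P = "PiE J' I"
  define E where "E \<alpha> = {\<omega>\<in>space M. (\<forall>j\<in>J'. \<eta> j \<omega> = \<alpha> j) \<and> r \<le> real (card {j\<in>J - J'. \<eta> j \<omega> \<in> \<Lambda> \<alpha>})}" for \<alpha>
  have fin: "finite J'" using J finite_subset by auto
  have finP: "finite ?P" using fin J I by (intro finite_PiE) auto
  have meas: "\<eta> j \<in> measurable M (count_space UNIV)" if "j \<in> J" for j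
    using indep that by (auto simp: indep_vars_def)
  have ev: "{\<omega>\<in>space M. Q (\<eta> j \<omega>)} \<in> events" if "j \<in> J" for j Q
    using measurable_sets[OF meas[OF that], of "{n. Q n}"] by (simp add: vimage_def Int_def conj_commute)
  have Em: "E \<alpha> \<in> events" for \<alpha>
  proof -
    have ce: "real (card {j\<in>J - J'. \<eta> j \<omega> \<in> \<Lambda> \<alpha>}) = (\<Sum>j\<in>J - J'. if \<eta> j \<omega> \<in> \<Lambda> \<alpha> then 1 else 0)" for \<omega>
      using J by (simp add: sum.If_cases Int_def)
    have m: "(\<lambda>\<omega>. \<Sum>j\<in>J - J'. if \<eta> j \<omega> \<in> \<Lambda> \<alpha> then 1 else (0::real)) \<in> borel_measurable M"
      by (intro borel_measurable_sum measurable_If ev) auto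
    have "E \<alpha> = {\<omega>\<in>space M. \<forall>j\<in>J'. \<eta> j \<omega> = \<alpha> j} \<inter> {\<omega>\<in>space M. r \<le> (\<Sum>j\<in>J - J'. if \<eta> j \<omega> \<in> \<Lambda> \<alpha> then 1 else 0)}"
      unfolding E_def ce by auto
    also have "\<dots> \<in> events"
      using J m fin by (intro sets.Int sets.sets_Collect_finite_All borel_measurable_le ev) auto
    finally show ?thesis .
  qed
  have A: "?A = (\<Union>\<alpha>\<in>?P. E \<alpha>)" by (auto simp: E_def)
  show "?A \<in> events" unfolding A using finP Em by auto
  from A have "prob ?A \<le> (\<Sum>\<alpha>\<in>?P. prob (E \<alpha>))"
    using finP Em by (simp add: finite_measure_subadditive_finite image_subset_iff)
  also have "\<dots> \<le> (\<Sum>\<alpha>\<in>?P. (\<Prod>j\<in>J'. prob {\<omega>\<in>space M. \<eta> j \<omega> = \<alpha> j}) * (\<theta> powr (- r) * exp (\<theta> * R)))"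
    unfolding E_def by (intro sum_mono Chernoff_given_values[OF J indep \<theta> R])
  also have "\<dots> = (\<Prod>j\<in>J'. \<Sum>n\<in>I j. prob {\<omega>\<in>space M. \<eta> j \<omega> = n}) * (\<theta> powr (- r) * exp (\<theta> * R))"
    using fin I J by (subst prod_sum_PiE) (auto simp: sum_distrib_right)
  also have "(\<Prod>j\<in>J'. \<Sum>n\<in>I j. prob {\<omega>\<in>space M. \<eta> j \<omega> = n}) \<le> (\<Prod>j\<in>J'. 1)"
  proof (intro prod_mono conjI sum_nonneg)
    fix j assume j: "j \<in> J'"
    then have jJ: "j \<in> J" using J by auto
    have "(\<Sum>n\<in>I j. prob {\<omega>\<in>space M. \<eta> j \<omega> = n}) = prob (\<Union>n\<in>I j. {\<omega>\<in>space M. \<eta> j \<omega> = n})"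
      using I jJ ev by (intro finite_measure_finite_Union[symmetric]) (auto simp: disjoint_family_on_def)
    also have "\<dots> \<le> 1" by (rule prob_le_1)
    finally show "(\<Sum>n\<in>I j. prob {\<omega>\<in>space M. \<eta> j \<omega> = n}) \<le> 1" .
  qed auto
  finally show "prob ?A \<le> \<theta> powr (- r) * exp (\<theta> * R)" by (simp add: mult_right_mono)
qed

section \<open>Counting the samples\<close>

text \<open>An average of \<open>m\<close> samples depends only on how often each element is drawn. Counting
  multiplicities instead of sequences saves the factor \<open>m\<close> factorial, which a union bound over \<open>exp (O(B))\<close>
  cases could not afford.\<close>
definition multiplicities :: "nat \<Rightarrow> 'a set \<Rightarrow> ('a \<Rightarrow> nat) set" where
  "multiplicities m X = {v \<in> PiE X (\<lambda>_. {..m}). sum v X = m}"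

lemma finite_multiplicities: "finite X \<Longrightarrow> finite (multiplicities m X)"
  unfolding multiplicities_def by (intro finite_subset[OF _ finite_PiE[of X "\<lambda>_. {..m}"]]) auto

text \<open>Give \<open>v\<close> the weight \<open>t ^ sum v X\<close>; the total weight of all functions is a product of geometric series.\<close>
lemma card_multiplicities_le:
  assumes X: "finite X" and t: "0 < t" "t < 1"
  shows "real (card (multiplicities m X)) * t ^ m \<le> (1 / (1 - t)) ^ card X"
proof -
  have "real (card (multiplicities m X)) * t ^ m = (\<Sum>v\<in>multiplicities m X. \<Prod>x\<in>X. t ^ v x)"
    by (simp add: multiplicities_def power_sum[symmetric])
  also have "\<dots> \<le> (\<Sum>v\<in>PiE X (\<lambda>_. {..m}). \<Prod>x\<in>X. t ^ v x)"
    using X t by (intro sum_mono2 finite_PiE) (auto simp: multiplicities_def intro!: prod_nonneg)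
  also have "\<dots> = (\<Prod>x\<in>X. \<Sum>i\<le>m. t ^ i)" using X by (subst prod_sum_PiE) auto
  also have "\<dots> \<le> (\<Prod>x\<in>X. 1 / (1 - t))"
  proof (intro prod_mono conjI)
    have "(\<Sum>i\<le>m. t ^ i) = (1 - t ^ Suc m) / (1 - t)" using t by (subst sum_gp0) auto
    also have "\<dots> \<le> 1 / (1 - t)" using t by (intro divide_right_mono) auto
    finally show "(\<Sum>i\<le>m. t ^ i) \<le> 1 / (1 - t)" .
  qed (use t in \<open>auto intro: sum_nonneg\<close>)
  finally show ?thesis by simp
qed

text \<open>The weight \<open>t\<close> is chosen proportional to \<open>B / L\<close>, so that the geometric series contribute
  \<open>exp (O(B))\<close>. The remaining factor is \<open>(1 / t) ^ m\<close>, and \<open>m * ln (1 / t)\<close> is a multiple of \<open>B\<close> times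
  \<open>sqrt (B / L) * ln (16 * L / B)\<close>, where the square root absorbs the logarithm.\<close>
lemma card_sample_multiplicities_le:
  fixes J :: "'a set"
  assumes J: "finite J" "J \<noteq> {}" and B: "1 \<le> B" "B \<le> card J"
  shows "real (card (multiplicities (sample_size B (card J)) (J \<times> {..<4::nat}))) \<le> exp (9 * real B)"
proof -
  define L where "L = card J"
  define m where "m = sample_size B L"
  define t where "t = real B / (16 * L)"
  let ?N = "real (card (multiplicities m (J \<times> {..<4::nat})))"
  have L: "L \<ge> 1" using B by (simp add: L_def)
  have t: "0 < t" "t \<le> 1/16" using B L by (auto simp: t_def L_def field_simps)
  have cX: "card (J \<times> {..<4::nat}) = 4 * L" by (simp add: L_def card_cartesian_product)
  have "1 / (1 - t) \<le> exp (2 * t)"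
  proof -
    have "1 \<le> (1 + 2 * t) * (1 - t)" using t by (simp add: algebra_simps power2_eq_square)
    also have "\<dots> \<le> exp (2 * t) * (1 - t)" using t exp_ge_add_one_self[of "2 * t"] by (intro mult_right_mono) auto
    finally show ?thesis using t by (simp add: field_simps)
  qed
  then have "(1 / (1 - t)) ^ (4 * L) \<le> exp (2 * t) ^ (4 * L)" using t by (intro power_mono) auto
  also have "\<dots> = exp (B / 2)" using L by (simp add: exp_of_nat_mult[symmetric] t_def)
  finally have A: "(1 / (1 - t)) ^ (4 * L) \<le> exp (B / 2)" .
  have "m * ln (1 / t) \<le> 8 * B"
  proof -
    have "ln (1 / t) = 2 * ln (sqrt (1 / t))" using t by (simp add: ln_sqrt)
    also have "\<dots> \<le> 2 * sqrt (1 / t)" using t ln_le_minus_one[of "sqrt (1/t)"] by simp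
    also have "\<dots> = 8 * sqrt (L / B)" by (simp add: t_def real_sqrt_divide real_sqrt_mult)
    finally have 1: "ln (1 / t) \<le> 8 * sqrt (L / B)" .
    have "sqrt (real B ^ 3 / L) * sqrt (L / B) = sqrt (real B ^ 2)"
      using B L by (simp add: real_sqrt_mult[symmetric] power2_eq_square power3_eq_cube)
    then have 2: "sqrt (real B ^ 3 / L) * sqrt (L / B) = B" by simp
    have "m * ln (1 / t) \<le> (sqrt (real B ^ 3 / L) / 1250) * (8 * sqrt (L / B))"
      using 1 sample_size_le[of B L] t by (intro mult_mono) (auto simp: m_def)
    also have "\<dots> = 8 * B / 1250" using 2 by (simp add: mult.commute)
    finally show ?thesis by simp
  qed
  then have "ln ((1 / t) ^ m) \<le> 8 * B" using t by (simp add: ln_realpow)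
  then have C: "(1 / t) ^ m \<le> exp (8 * B)" using t by (metis exp_le_cancel_iff exp_ln zero_less_divide_1_iff zero_less_power)
  have "?N * t ^ m \<le> exp (B / 2)"
    using card_multiplicities_le[of "J \<times> {..<4::nat}" t m] J t A unfolding cX by simp
  then have "?N * t ^ m * (1 / t) ^ m \<le> exp (B / 2) * exp (8 * B)" using C t by (intro mult_mono) auto
  moreover have "?N * t ^ m * (1 / t) ^ m = ?N" using t by (simp add: power_one_over)
  ultimately have "?N \<le> exp (B / 2) * exp (8 * B)" by linarith
  also have "\<dots> = exp (B / 2 + 8 * B)" by (rule exp_add[symmetric])
  also have "\<dots> \<le> exp (9 * B)" by simp
  finally show ?thesis by (simp add: m_def L_def)
qed

section \<open>The supremum is small outside a rare event\<close>

definition multiplicity_poly :: "nat \<Rightarrow> (nat \<times> nat \<Rightarrow> nat) \<Rightarrow> nat set \<Rightarrow> (nat \<Rightarrow> int) \<Rightarrow> real \<Rightarrow> complex" where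
  "multiplicity_poly m v J \<alpha> t =
     (\<Sum>(j, k)\<in>J \<times> {..<4}. of_nat (v (j, k)) * (\<i> ^ k * e (of_int (\<alpha> j) * t))) / of_nat m"

definition used_indices :: "(nat \<times> nat \<Rightarrow> nat) \<Rightarrow> nat set \<Rightarrow> nat set" where
  "used_indices v J = {j\<in>J. \<exists>k<4. 0 < v (j, k)}"

text \<open>This is the independence at the heart of the union bound: the average is a function of the points
  that were drawn.\<close>
lemma multiplicity_poly_cong:
  assumes "\<And>j. j \<in> used_indices v J \<Longrightarrow> \<alpha> j = \<beta> j"
  shows "multiplicity_poly m v J \<alpha> = multiplicity_poly m v J \<beta>"
proof
  fix t
  show "multiplicity_poly m v J \<alpha> t = multiplicity_poly m v J \<beta> t"
    unfolding multiplicity_poly_def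
  proof (intro arg_cong2[of _ _ _ _ "(/)"] sum.cong refl)
    fix x assume x: "x \<in> J \<times> {..<4::nat}"
    obtain j k where jk: "x = (j, k)" "j \<in> J" "k < 4" using x by auto
    show "(case x of (j, k) \<Rightarrow> of_nat (v (j, k)) * (\<i> ^ k * e (of_int (\<alpha> j) * t))) =
      (case x of (j, k) \<Rightarrow> of_nat (v (j, k)) * (\<i> ^ k * e (of_int (\<beta> j) * t)))"
    proof (cases "v (j, k) = 0")
      case False
      then have "j \<in> used_indices v J" using jk by (auto simp: used_indices_def)
      then show ?thesis using assms jk by simp
    qed (simp add: jk)
  qed
qed

lemma card_used_indices_le:
  assumes J: "finite J" and v: "v \<in> multiplicities m (J \<times> {..<4})"
  shows "card (used_indices v J) \<le> m"
proof -
  have "card (used_indices v J) = (\<Sum>j\<in>used_indices v J. 1)" by simp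
  also have "\<dots> \<le> (\<Sum>j\<in>used_indices v J. \<Sum>k<4. v (j, k))"
  proof (intro sum_mono)
    fix j assume "j \<in> used_indices v J"
    then obtain k where "k < 4" "0 < v (j, k)" by (auto simp: used_indices_def)
    then show "1 \<le> (\<Sum>k<4. v (j, k))" using member_le_sum[of k "{..<4}" "\<lambda>k. v (j, k)"] by force
  qed
  also have "\<dots> \<le> (\<Sum>j\<in>J. \<Sum>k<4. v (j, k))"
    using J by (intro sum_mono2) (auto simp: used_indices_def)
  also have "\<dots> = m" using v by (simp add: multiplicities_def sum.cartesian_product)
  finally show ?thesis .
qed

lemma sample_poly_as_multiplicity_poly:
  assumes J: "finite J" and inj: "inj_on \<eta> J" and \<sigma>: "\<sigma> \<in> {..<m} \<rightarrow> \<eta> ` J \<times> {..<4}"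
  obtains v where "v \<in> multiplicities m (J \<times> {..<4})" "sample_poly m \<sigma> = multiplicity_poly m v J \<eta>"
proof -
  let ?X = "J \<times> {..<4::nat}"
  let ?Y = "\<eta> ` J \<times> {..<4::nat}"
  define g where "g = (\<lambda>(j, k). (\<eta> j, k :: nat))"
  define v where "v = restrict (\<lambda>x. card {l\<in>{..<m}. \<sigma> l = g x}) ?X"
  have bij: "bij_betw g ?X ?Y"
    using inj by (auto simp: bij_betw_def inj_on_def g_def image_iff)
  have group: "(\<Sum>x\<in>?X. of_nat (v x) * h (g x)) = (\<Sum>l<m. h (\<sigma> l))" for h :: "int \<times> nat \<Rightarrow> 'b::comm_semiring_1"
  proof -
    have "(\<Sum>x\<in>?X. of_nat (v x) * h (g x)) = (\<Sum>x\<in>?X. of_nat (card {l\<in>{..<m}. \<sigma> l = g x}) * h (g x))"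
      by (intro sum.cong refl) (simp add: v_def)
    also have "\<dots> = (\<Sum>y\<in>?Y. of_nat (card {l\<in>{..<m}. \<sigma> l = y}) * h y)"
      using sum.reindex_bij_betw[OF bij, of "\<lambda>y. of_nat (card {l\<in>{..<m}. \<sigma> l = y}) * h y"] .
    also have "\<dots> = (\<Sum>y\<in>?Y. \<Sum>l\<in>{l\<in>{..<m}. \<sigma> l = y}. h (\<sigma> l))" by simp
    also have "\<dots> = (\<Sum>l<m. h (\<sigma> l))" by (rule sum.group) (use J \<sigma> in \<open>auto simp only: image_subset_iff_funcset finite_lessThan finite_cartesian_product finite_imageI\<close>)
    finally show ?thesis .
  qed
  have "card {l\<in>{..<m}. \<sigma> l = y} \<le> m" for y
    using card_mono[of "{..<m}" "{l\<in>{..<m}. \<sigma> l = y}"] by auto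
  then have "v \<in> PiE ?X (\<lambda>_. {..m})"
    unfolding v_def restrict_PiE_iff by blast
  moreover have "sum v ?X = m" using group[of "\<lambda>_. 1 :: nat"] by simp
  ultimately have vm: "v \<in> multiplicities m ?X" by (simp add: multiplicities_def)
  have "sample_poly m \<sigma> t = multiplicity_poly m v J \<eta> t" for t
    using group[of "\<lambda>y. \<i> ^ snd y * e (of_int (fst y) * t)"]
    by (simp add: sample_poly_def multiplicity_poly_def g_def case_prod_unfold)
  then show ?thesis using that[OF vm] by blast
qed

text \<open>The value of \<open>\<rho>\<close>. With \<open>\<theta> = 1 / \<rho>\<close>, at least \<open>B / 1250\<close> hits have probability at most
  \<open>\<rho> powr (B / 1250) * exp B = exp (- 11 * B) * exp B\<close>, which outweighs the number \<open>exp (9 * B)\<close> of samples.\<close>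
definition density_const :: real where
  "density_const = exp (- 13750)"

lemma (in prob_space) prob_hits_le:
  fixes \<eta> :: "nat \<Rightarrow> 'a \<Rightarrow> int" and s :: real
  assumes J: "finite J" and ev: "\<And>j n. j \<in> J \<Longrightarrow> {\<omega>\<in>space M. \<eta> j \<omega> = n} \<in> events"
    and I: "\<And>j. j \<in> J \<Longrightarrow> finite (I j)" "\<And>j. j \<in> J \<Longrightarrow> AE \<omega> in M. \<eta> j \<omega> \<in> I j"
    and disj: "disjoint_family_on I J"
    and unif: "\<And>j n. j \<in> J \<Longrightarrow> prob {\<omega>\<in>space M. \<eta> j \<omega> = n} \<le> 1 / s"
  shows "(\<Sum>j\<in>J. prob {\<omega>\<in>space M. \<eta> j \<omega> \<in> \<Lambda>}) \<le> card (\<Lambda> \<inter> (\<Union>j\<in>J. I j)) / s"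
proof -
  have "prob {\<omega>\<in>space M. \<eta> j \<omega> \<in> \<Lambda>} \<le> card (\<Lambda> \<inter> I j) / s" if j: "j \<in> J" for j
  proof -
    let ?U = "\<Union>n\<in>\<Lambda> \<inter> I j. {\<omega>\<in>space M. \<eta> j \<omega> = n}"
    have U: "?U \<in> events" using I(1)[OF j] ev[OF j] by auto
    have "prob {\<omega>\<in>space M. \<eta> j \<omega> \<in> \<Lambda>} \<le> prob ?U"
    proof (cases "{\<omega>\<in>space M. \<eta> j \<omega> \<in> \<Lambda>} \<in> events")
      case True
      then show ?thesis using I(2)[OF j] by (intro finite_measure_mono_AE U) auto
    qed (simp add: measure_notin_sets)
    also have "\<dots> \<le> (\<Sum>n\<in>\<Lambda> \<inter> I j. prob {\<omega>\<in>space M. \<eta> j \<omega> = n})"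
      using I(1)[OF j] ev[OF j] by (intro finite_measure_subadditive_finite) auto
    also have "\<dots> \<le> (\<Sum>n\<in>\<Lambda> \<inter> I j. 1 / s)" using unif[OF j] by (intro sum_mono)
    finally show ?thesis by simp
  qed
  then have "(\<Sum>j\<in>J. prob {\<omega>\<in>space M. \<eta> j \<omega> \<in> \<Lambda>}) \<le> (\<Sum>j\<in>J. card (\<Lambda> \<inter> I j) / s)" by (rule sum_mono)
  also have "\<dots> = real (\<Sum>j\<in>J. card (\<Lambda> \<inter> I j)) / s" by (simp add: sum_divide_distrib)
  also have "(\<Sum>j\<in>J. card (\<Lambda> \<inter> I j)) = card (\<Union>j\<in>J. \<Lambda> \<inter> I j)"
  proof (rule card_UN_disjoint[symmetric])
    show "\<forall>i\<in>J. \<forall>j\<in>J. i \<noteq> j \<longrightarrow> (\<Lambda> \<inter> I i) \<inter> (\<Lambda> \<inter> I j) = {}"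
      using disj unfolding disjoint_family_on_def by blast
  qed (use J I in auto)
  also have "(\<Union>j\<in>J. \<Lambda> \<inter> I j) = \<Lambda> \<inter> (\<Union>j\<in>J. I j)" by auto
  finally show ?thesis .
qed

text \<open>The exceptional event is the union, over the possible sizes \<open>B\<close> and multiplicities \<open>v\<close>, of the events that
  the spectrum determined by the drawn points receives \<open>B / 1250\<close> of the other points. If the
  supremum is large, then \<open>large_sup_norm_imp_structured\<close> provides \<open>B / 625\<close> points in the spectrum,
  and at most half of them were drawn themselves.\<close>
lemma (in prob_space) sup_norm_le_outside_rare_event:
  fixes \<eta> :: "nat \<Rightarrow> 'a \<Rightarrow> int" and s Y p :: real
  assumes p: "p > 2" and J: "finite J" "J \<noteq> {}"
    and indep: "indep_vars (\<lambda>_. count_space UNIV) \<eta> J"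
    and I: "\<And>j. j \<in> J \<Longrightarrow> finite (I j)" "\<And>j. j \<in> J \<Longrightarrow> AE \<omega> in M. \<eta> j \<omega> \<in> I j"
    and disj: "disjoint_family_on I J"
    and s: "s > 0" and unif: "\<And>j n. j \<in> J \<Longrightarrow> prob {\<omega>\<in>space M. \<eta> j \<omega> = n} \<le> 1 / s"
    and Y: "threshold p \<le> Y" "4 * 5 powr p / density_const * (card J powr (p/2 - 1) / s) \<le> Y powr p"
  obtains E where "E \<in> events" "prob E \<le> card J * exp (- (card J powr (1/3)))"
    "\<And>\<omega>. \<omega> \<in> space M \<Longrightarrow> (\<And>j. j \<in> J \<Longrightarrow> \<eta> j \<omega> \<in> I j) \<Longrightarrow> \<omega> \<notin> E
       \<Longrightarrow> sup_norm p ((\<lambda>j. \<eta> j \<omega>) ` J) \<le> Y * sqrt (card J)"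
proof -
  define L where "L = card J"
  have L: "L \<ge> 1" using J by (simp add: L_def Suc_le_eq card_gt_0_iff)
  have Y0: "Y > 0" using Y(1) by (simp add: threshold_def)
  define \<rho> where "\<rho> = density_const"
  have \<rho>: "0 < \<rho>" "\<rho> \<le> 1" by (simp_all add: \<rho>_def density_const_def)
  define W where "W = (\<Union>j\<in>J. I j)"
  have W: "finite W" using J I by (auto simp: W_def)
  define m where "m B = sample_size B L" for B
  define V where "V B = multiplicities (m B) (J \<times> {..<4::nat})" for B
  define q where "q B v \<alpha> = multiplicity_poly (m B) v J \<alpha>" for B v \<alpha>
  \<comment> \<open>Averages of small norm are discarded: only for the others is the spectrum known to be sparse.\<close>
  define \<Lambda> where "\<Lambda> B v \<alpha> = (if Y / 5 * (L / real B ^ 3) powr (1/4) \<le> Lp_norm p (q B v \<alpha>)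
     \<and> (\<exists>\<sigma>. q B v \<alpha> = sample_poly (m B) \<sigma>) then spectrum p (q B v \<alpha>) else {})" for B v \<alpha>
  define \<B> where "\<B> = {B. 1 \<le> B \<and> B \<le> L \<and> L \<le> B ^ 3}"
  have fB: "finite \<B>" and cB: "card \<B> \<le> L"
  proof -
    have "\<B> \<subseteq> {1..L}" by (auto simp: \<B>_def)
    then show "finite \<B>" "card \<B> \<le> L" using finite_subset card_mono[of "{1..L}" \<B>] by auto
  qed
  define E where "E B v = {\<omega>\<in>space M. \<exists>\<alpha>\<in>PiE (used_indices v J) I. (\<forall>j\<in>used_indices v J. \<eta> j \<omega> = \<alpha> j)
      \<and> real B / 1250 \<le> real (card {j\<in>J - used_indices v J. \<eta> j \<omega> \<in> \<Lambda> B v \<alpha>})}" for B v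
  have sub: "used_indices v J \<subseteq> J" for v by (auto simp: used_indices_def)
  have meas: "\<eta> j \<in> measurable M (count_space UNIV)" if "j \<in> J" for j
    using indep that by (auto simp: indep_vars_def)
  have ev: "{\<omega>\<in>space M. \<eta> j \<omega> = n} \<in> events" if "j \<in> J" for j n
    using measurable_sets[OF meas[OF that], of "{n}"] by (simp add: vimage_def Int_def conj_commute)
  have R: "(\<Sum>j\<in>J - used_indices v J. prob {\<omega>\<in>space M. \<eta> j \<omega> \<in> \<Lambda> B v \<alpha>}) \<le> \<rho> * B" if B: "B \<in> \<B>" for B v \<alpha>
  proof -
    have "(\<Sum>j\<in>J - used_indices v J. prob {\<omega>\<in>space M. \<eta> j \<omega> \<in> \<Lambda> B v \<alpha>}) \<le> (\<Sum>j\<in>J. prob {\<omega>\<in>space M. \<eta> j \<omega> \<in> \<Lambda> B v \<alpha>})"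
      using J by (intro sum_mono2) auto
    also have "\<dots> \<le> card (\<Lambda> B v \<alpha> \<inter> W) / s"
      unfolding W_def by (intro prob_hits_le J ev I disj unif)
    also have "\<dots> \<le> (\<rho> * s * B) / s"
    proof (intro divide_right_mono)
      show "real (card (\<Lambda> B v \<alpha> \<inter> W)) \<le> \<rho> * s * B"
      proof (cases "\<Lambda> B v \<alpha> = {}")
        case True
        then show ?thesis using \<rho> s by simp
      next
        case False
        then have big: "Y / 5 * (L / real B ^ 3) powr (1/4) \<le> Lp_norm p (q B v \<alpha>)"
          and \<Lambda>: "\<Lambda> B v \<alpha> = spectrum p (q B v \<alpha>)" and "\<exists>\<sigma>. q B v \<alpha> = sample_poly (m B) \<sigma>"
          by (auto simp: \<Lambda>_def split: if_splits)
        then obtain \<sigma> where \<sigma>: "q B v \<alpha> = sample_poly (m B) \<sigma>" by blast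
        show ?thesis
          using B W Y(2) unfolding \<Lambda>
          by (intro spectrum_density[where Y = Y and L = L, OF p s \<rho>(1) Y0 _ _ _ _ _ big])
             (auto simp: \<B>_def \<rho>_def L_def \<sigma> norm_sample_poly_le continuous_sample_poly)
      qed
    qed (use s in auto)
    finally show ?thesis using s by simp
  qed
  have Em: "E B v \<in> events" and Ep: "prob (E B v) \<le> exp (- 10 * real B)" if B: "B \<in> \<B>" for B v
  proof -
    have \<theta>: "1 \<le> 1 / \<rho>" using \<rho> by simp
    note C = Chernoff_decoupled[where \<Lambda> = "\<Lambda> B v" and r = "real B / 1250", OF J(1) sub indep I \<theta> R[OF B]]
    show "E B v \<in> events" unfolding E_def by (rule C(2)) auto
    have "prob (E B v) \<le> (1 / \<rho>) powr (- (real B / 1250)) * exp (1 / \<rho> * (\<rho> * B))"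
      unfolding E_def by (rule C(1)) auto
    also have "(1 / \<rho>) powr (- (real B / 1250)) = exp (- 11 * B)"
      by (simp add: \<rho>_def density_const_def powr_def ln_div)
    also have "exp (- 11 * B) * exp (1 / \<rho> * (\<rho> * B)) = exp (- 10 * real B)"
      using \<rho> by (simp flip: exp_add)
    finally show "prob (E B v) \<le> exp (- 10 * real B)" .
  qed
  have fV: "finite (V B)" for B using J by (simp add: V_def finite_multiplicities)
  define EE where "EE = (\<Union>B\<in>\<B>. \<Union>v\<in>V B. E B v)"
  have EEm: "EE \<in> events" unfolding EE_def using fB fV Em by (intro sets.finite_UN) auto
  have "prob EE \<le> (\<Sum>B\<in>\<B>. prob (\<Union>v\<in>V B. E B v))"
    unfolding EE_def using fB fV Em by (intro finite_measure_subadditive_finite) (auto intro!: sets.finite_UN)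
  also have "\<dots> \<le> (\<Sum>B\<in>\<B>. exp (- (L powr (1/3))))"
  proof (intro sum_mono)
    fix B assume B: "B \<in> \<B>"
    have "prob (\<Union>v\<in>V B. E B v) \<le> (\<Sum>v\<in>V B. prob (E B v))"
      using B fV Em by (intro finite_measure_subadditive_finite) auto
    also have "\<dots> \<le> (\<Sum>v\<in>V B. exp (- 10 * real B))" using B by (intro sum_mono Ep)
    also have "\<dots> = card (V B) * exp (- 10 * real B)" by simp
    also have "\<dots> \<le> exp (9 * real B) * exp (- 10 * real B)"
      using card_sample_multiplicities_le[OF J, of B] B
      by (intro mult_right_mono) (auto simp: V_def m_def L_def \<B>_def)
    also have "\<dots> = exp (- real B)" by (simp flip: exp_add)
    also have "\<dots> \<le> exp (- (L powr (1/3)))"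
    proof -
      have "real L \<le> real B ^ 3" using B by (auto simp: \<B>_def simp flip: of_nat_power)
      then have "L powr (1/3) \<le> (real B ^ 3) powr (1/3)" by (intro powr_mono2) auto
      also have "\<dots> = B" using B by (simp add: \<B>_def powr_powr flip: powr_numeral)
      finally show ?thesis by simp
    qed
    finally show "prob (\<Union>v\<in>V B. E B v) \<le> exp (- (L powr (1/3)))" .
  qed
  also have "\<dots> = card \<B> * exp (- (L powr (1/3)))" by simp
  also have "\<dots> \<le> L * exp (- (L powr (1/3)))" using cB by (intro mult_right_mono) auto
  finally have EEp: "prob EE \<le> L * exp (- (L powr (1/3)))" .
  have "sup_norm p ((\<lambda>j. \<eta> j \<omega>) ` J) \<le> Y * sqrt L"
    if \<omega>: "\<omega> \<in> space M" "\<And>j. j \<in> J \<Longrightarrow> \<eta> j \<omega> \<in> I j" "\<omega> \<notin> EE" for \<omega>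
  proof (rule ccontr)
    assume "\<not> ?thesis"
    then have large: "Y * sqrt L < sup_norm p ((\<lambda>j. \<eta> j \<omega>) ` J)" by simp
    let ?h = "\<lambda>j. \<eta> j \<omega>"
    let ?S = "?h ` J"
    have inj: "inj_on ?h J"
      using \<omega>(2) disj by (force simp: inj_on_def disjoint_family_on_def)
    have cS: "card ?S = L" using inj by (simp add: card_image L_def)
    obtain B \<sigma> where B: "1 \<le> B" "B \<le> L" "L \<le> B ^ 3" "1 \<le> m B"
      and \<sigma>: "\<sigma> \<in> {..<m B} \<rightarrow> ?S \<times> {..<4}"
      and big: "Y / 5 * (L / real B ^ 3) powr (1/4) \<le> Lp_norm p (sample_poly (m B) \<sigma>)"
      and hits: "real B / 625 \<le> card (?S \<inter> spectrum p (sample_poly (m B) \<sigma>))"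
      using large_sup_norm_imp_structured[OF p _ _ Y(1), of ?S] large J unfolding cS m_def by blast
    have B\<B>: "B \<in> \<B>" using B by (simp add: \<B>_def)
    obtain v where v: "v \<in> V B" and vq: "sample_poly (m B) \<sigma> = multiplicity_poly (m B) v J ?h"
      using sample_poly_as_multiplicity_poly[OF J(1) inj \<sigma>] unfolding V_def by blast
    let ?J' = "used_indices v J"
    define \<alpha> where "\<alpha> = restrict ?h ?J'"
    have \<alpha>: "\<alpha> \<in> PiE ?J' I" using \<omega>(2) sub by (auto simp: \<alpha>_def)
    have q\<alpha>: "q B v \<alpha> = sample_poly (m B) \<sigma>"
      unfolding q_def vq by (rule multiplicity_poly_cong) (simp add: \<alpha>_def)
    have \<Lambda>: "\<Lambda> B v \<alpha> = spectrum p (sample_poly (m B) \<sigma>)"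
      using big by (auto simp: \<Lambda>_def q\<alpha>)
    have mB: "real (m B) \<le> real B / 1250"
    proof -
      have "real B ^ 3 \<le> real B ^ 2 * L" using B by (simp add: power2_eq_square power3_eq_cube mult_left_mono)
      then have "real B ^ 3 / L \<le> real B ^ 2" using L by (simp add: field_simps)
      then have "sqrt (real B ^ 3 / L) \<le> sqrt (real B ^ 2)" by (rule real_sqrt_le_mono)
      then show ?thesis using sample_size_le[of B L] by (simp add: m_def)
    qed
    have "?S \<inter> \<Lambda> B v \<alpha> \<subseteq> ?h ` ({j\<in>J - ?J'. ?h j \<in> \<Lambda> B v \<alpha>} \<union> ?J')" by auto
    then have "card (?S \<inter> \<Lambda> B v \<alpha>) \<le> card (?h ` ({j\<in>J - ?J'. ?h j \<in> \<Lambda> B v \<alpha>} \<union> ?J'))"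
      using J finite_subset[OF sub J(1)] by (intro card_mono) auto
    also have "\<dots> \<le> card ({j\<in>J - ?J'. ?h j \<in> \<Lambda> B v \<alpha>} \<union> ?J')"
      using J finite_subset[OF sub J(1)] by (intro card_image_le) auto
    also have "\<dots> \<le> card {j\<in>J - ?J'. ?h j \<in> \<Lambda> B v \<alpha>} + card ?J'" by (rule card_Un_le)
    also have "card ?J' \<le> m B" using card_used_indices_le[OF J(1)] v by (simp add: V_def)
    finally have "card (?S \<inter> \<Lambda> B v \<alpha>) \<le> card {j\<in>J - ?J'. ?h j \<in> \<Lambda> B v \<alpha>} + m B" by simp
    then have "real (card (?S \<inter> \<Lambda> B v \<alpha>)) \<le> real (card {j\<in>J - ?J'. ?h j \<in> \<Lambda> B v \<alpha>}) + real (m B)" by linarith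
    then have "real B / 1250 \<le> real (card {j\<in>J - ?J'. ?h j \<in> \<Lambda> B v \<alpha>})"
      using hits mB unfolding \<Lambda> by linarith
    then have "\<omega> \<in> E B v" using \<omega>(1) \<alpha> unfolding E_def by (auto simp: \<alpha>_def intro!: bexI[of _ \<alpha>])
    then show False using \<omega>(3) B\<B> v unfolding EE_def by blast
  qed
  then show ?thesis using that[OF EEm] EEp by (simp add: L_def)
qed

section \<open>Lower bounds for the majorant\<close>

lemma majorant_norm_ge_sqrt_card:
  assumes p: "p > 2" and S: "finite S"
  shows "sqrt (card S) \<le> majorant_norm p S"
proof -
  have "real (card S) = (\<integral>x. (norm (exp_sum (\<lambda>_. 1) S x))\<^sup>2 \<partial>unit_interval)"
    using Parseval_exp_sum[OF S, of "\<lambda>_. 1"] by simp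
  also have "\<dots> \<le> (majorant_norm p S)\<^sup>2"
    unfolding majorant_norm_def by (intro L2_le_Lp_norm p continuous_exp_sum)
  finally show ?thesis
    by (intro real_le_lsqrt) (auto simp: majorant_norm_def Lp_norm_nonneg)
qed

lemma Re_e_ge_half:
  assumes "\<bar>t\<bar> \<le> 1/6"
  shows "1/2 \<le> Re (e t)"
proof -
  have "Re (e t) = cos \<bar>2 * pi * t\<bar>" by (simp add: e_def Re_exp)
  also have "\<dots> \<ge> cos (pi / 3)"
  proof (rule cos_monotone_0_pi_le)
    have "2 * pi * \<bar>t\<bar> \<le> 2 * pi * (1/6)" using assms by (intro mult_left_mono) auto
    then show "\<bar>2 * pi * t\<bar> \<le> pi / 3" by (simp add: abs_mult)
  qed auto
  finally show ?thesis by (simp add: cos_60)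
qed

text \<open>On an interval of length \<open>d = 1 / (32 * a * L)\<close> to the right of \<open>k / a\<close>, the phase of each summand
  differs from the common phase \<open>b * k / a\<close> by less than a sixth of a turn: the displacement from \<open>k / a\<close>
  accounts for at most \<open>5/64\<close>, and the perturbation, of size at most \<open>s\<close>, for at most
  \<open>s * k / a \<le> 1/32\<close>. So the sum is at least \<open>L / 2\<close> there, and there are more than \<open>a / (32 * s)\<close> such
  intervals.\<close>
lemma majorant_norm_perturbed_progression_ge:
  fixes a b :: int and \<eta> :: "nat \<Rightarrow> int" and s p :: real
  assumes p: "p > 0" and ab: "0 < b" "b < a" and s: "1 \<le> s" "s < a / 2" and L: "1 \<le> L"
    and \<eta>: "\<And>j. j \<in> {1..L} \<Longrightarrow> \<bar>real_of_int (\<eta> j - (b + a * int j))\<bar> \<le> s"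
    and inj: "inj_on \<eta> {1..L}"
  shows "(real L / 2) powr p / (1024 * s * L) \<le> majorant_norm p (\<eta> ` {1..L}) powr p"
proof -
  define F where "F = exp_sum (\<lambda>_. 1) (\<eta> ` {1..L})"
  have F: "F x = (\<Sum>j\<in>{1..L}. e (of_int (\<eta> j) * x))" for x
    using inj by (simp add: F_def exp_sum_def sum.reindex)
  have a0: "real_of_int a > 0" using ab by simp
  define n where "n = nat \<lfloor>a / (32 * s)\<rfloor>"
  define d where "d = 1 / (32 * a * real L)"
  have d0: "d > 0" using a0 L by (simp add: d_def)
  define A where "A k = {real k / a .. real k / a + d}" for k :: nat
  have ks: "real k * s / a \<le> 1/32" if "k \<le> n" for k
  proof -
    have "real k \<le> real n" using that by simp
    also have "\<dots> \<le> a / (32 * s)" unfolding n_def using a0 s by (intro of_nat_floor) auto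
    finally show ?thesis using a0 s by (simp add: field_simps)
  qed
  have large: "real L / 2 \<le> norm (F x)" if x: "x \<in> A k" and k: "k \<le> n" for x k
  proof -
    define y where "y = x - real k / a"
    have y: "0 \<le> y" "y \<le> d" and xy: "x = real k / a + y" using x by (auto simp: A_def y_def)
    have summand: "1/2 \<le> Re (e (- (of_int b * (real k / a))) * e (of_int (\<eta> j) * x))" if j: "j \<in> {1..L}" for j
    proof -
      define \<tau> where "\<tau> = of_int (\<eta> j) * y + of_int (\<eta> j - (b + a * int j)) * (real k / a)"
      have "- (of_int b * (real k / a)) + of_int (\<eta> j) * x = of_int (int j * int k) + \<tau>"
        using a0 by (simp add: xy \<tau>_def field_simps)
      then have "e (- (of_int b * (real k / a))) * e (of_int (\<eta> j) * x) = e \<tau>"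
        by (metis e_add e_of_int mult_1)
      moreover have "\<bar>\<tau>\<bar> \<le> 1/6"
      proof -
        have jL: "real j \<le> L" "1 \<le> real L" using j L by auto
        have "\<bar>real_of_int (\<eta> j)\<bar> \<le> \<bar>real_of_int (b + a * int j)\<bar> + s" using \<eta>[OF j] by simp
        moreover have "\<bar>real_of_int (b + a * int j)\<bar> = real_of_int b + real_of_int a * real j" using ab by simp
        moreover have "real_of_int a * real j \<le> real_of_int a * real L" "real_of_int a * 1 \<le> real_of_int a * real L"
          using jL a0 by (intro mult_left_mono; simp)+
        moreover have "real_of_int b < real_of_int a" using ab by simp
        ultimately have "\<bar>real_of_int (\<eta> j)\<bar> \<le> 5/2 * (a * real L)" using s by linarith
        then have "\<bar>of_int (\<eta> j) * y\<bar> \<le> 5/2 * (a * real L) * d"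
          using y unfolding abs_mult by (intro mult_mono) auto
        also have "\<dots> = 5/64" using a0 L by (simp add: d_def)
        finally have 1: "\<bar>of_int (\<eta> j) * y\<bar> \<le> 5/64" .
        have "\<bar>of_int (\<eta> j - (b + a * int j)) * (real k / a)\<bar> \<le> s * (real k / a)"
          using \<eta>[OF j] a0 by (simp only: abs_mult) (intro mult_mono, auto)
        also have "\<dots> \<le> 1/32" using ks[OF k] by (simp add: mult.commute)
        finally show ?thesis using 1 unfolding \<tau>_def by linarith
      qed
      ultimately show ?thesis using Re_e_ge_half by metis
    qed
    have "real L / 2 = (\<Sum>j\<in>{1..L}. 1/2)" by simp
    also have "\<dots> \<le> (\<Sum>j\<in>{1..L}. Re (e (- (of_int b * (real k / a))) * e (of_int (\<eta> j) * x)))"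
      by (intro sum_mono summand)
    also have "\<dots> = Re (e (- (of_int b * (real k / a))) * F x)" by (simp only: F sum_distrib_left Re_sum)
    also have "\<dots> \<le> norm (e (- (of_int b * (real k / a))) * F x)" by (rule complex_Re_le_cmod)
    also have "\<dots> = norm (F x)" by (simp add: norm_mult)
    finally show ?thesis .
  qed
  have sub: "A k \<subseteq> {0..1}" if "k \<le> n" for k
  proof -
    have "real k * 1 / a \<le> real k * s / a" using s a0 by (intro divide_right_mono mult_left_mono) auto
    then have "real k / a \<le> 1/32" using ks[OF that] unfolding mult_1_right by linarith
    moreover have "1 * 1 \<le> a * real L" using ab L by (intro mult_mono) auto
    then have "d \<le> 1/32" by (simp add: d_def field_simps)
    moreover have "0 \<le> real k / a" using a0 by simp
    ultimately have "real k / a + d \<le> 1" "0 \<le> real k / a" by linarith+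
    then show ?thesis by (auto simp: A_def)
  qed
  have Am: "A k \<in> sets unit_interval" if "k \<le> n" for k
    using sub[OF that] by (auto simp: sets_restrict_space A_def image_iff intro!: bexI[of _ "A k"])
  have mA: "measure unit_interval (A k) = d" if "k \<le> n" for k
    using sub[OF that] d0 by (subst measure_restrict_space) (auto simp: A_def)
  have disj: "disjoint_family_on A {..n}"
  proof -
    have "d < 1 / a"
    proof -
      have "1 * 1 \<le> a * real L" using ab L by (intro mult_mono) auto
      then show ?thesis using a0 L by (simp add: d_def field_simps)
    qed
    have "A k \<inter> A l = {}" if "k < l" for k l
    proof -
      have "real k + 1 \<le> real l" using that by simp
      then have "(real k + 1) / a \<le> real l / a" using a0 by (intro divide_right_mono) auto
      then have "real k / a + d < real l / a" using \<open>d < 1 / a\<close> by (simp add: add_divide_distrib)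
      then show ?thesis by (auto simp: A_def)
    qed
    then show ?thesis unfolding disjoint_family_on_def by (metis Int_commute nat_neq_iff)
  qed
  have "measure unit_interval (\<Union>k\<le>n. A k) = (\<Sum>k\<le>n. measure unit_interval (A k))"
    using Am disj by (intro unit_interval.finite_measure_finite_Union) auto
  also have "\<dots> = (n + 1) * d" by (simp add: mA)
  finally have m: "measure unit_interval (\<Union>k\<le>n. A k) = (n + 1) * d" .
  have "a / (32 * s) \<le> n + 1" unfolding n_def using a0 s by linarith
  then have "a / (32 * s) * d \<le> (n + 1) * d" using d0 by (intro mult_right_mono) auto
  moreover have "a / (32 * s) * d = 1 / (1024 * s * L)" using a0 by (simp add: d_def)
  ultimately have mm: "1 / (1024 * s * L) \<le> measure unit_interval (\<Union>k\<le>n. A k)" unfolding m by simp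
  have Um: "(\<Union>k\<le>n. A k) \<in> sets unit_interval" using Am by (intro sets.finite_UN) auto
  have "(real L / 2) powr p / (1024 * s * L) \<le> (real L / 2) powr p * measure unit_interval (\<Union>k\<le>n. A k)"
    using mult_left_mono[OF mm, of "(real L / 2) powr p"] by simp
  also have "\<dots> = (\<integral>x. (real L / 2) powr p * indicator (\<Union>k\<le>n. A k) x \<partial>unit_interval)"
    by (simp only: integral_mult_right_zero Bochner_Integration.integral_indicator sets.Int_space_eq2[OF Um])
  also have "\<dots> \<le> (\<integral>x. norm (F x) powr p \<partial>unit_interval)"
  proof (rule integral_mono)
    show "integrable unit_interval (\<lambda>x. (real L / 2) powr p * indicator (\<Union>k\<le>n. A k) x)"
      using Um by (intro integrable_mult_right integrable_real_indicator) (auto simp: unit_interval.emeasure_eq_measure)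
    show "integrable unit_interval (\<lambda>x. norm (F x) powr p)"
      unfolding F_def by (intro integrable_continuous_unit_interval continuous_powr_norm continuous_exp_sum p)
    show "(real L / 2) powr p * indicator (\<Union>k\<le>n. A k) x \<le> norm (F x) powr p" for x
    proof (cases "x \<in> (\<Union>k\<le>n. A k)")
      case True
      then obtain k where "k \<le> n" "x \<in> A k" by auto
      then have "real L / 2 \<le> norm (F x)" using large by blast
      then show ?thesis using True p by (simp add: powr_mono2)
    qed simp
  qed
  also have "\<dots> = majorant_norm p (\<eta> ` {1..L}) powr p"
    using p by (simp add: majorant_norm_def F_def Lp_norm_powr)
  finally show ?thesis .
qed

section \<open>Random perturbations of an arithmetic progression\<close>

lemma ap_indices_eq: "ap_indices N \<epsilon>\<^sub>0 = {1..nat \<lfloor>real N powr \<epsilon>\<^sub>0\<rfloor>}"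
  by (auto simp: ap_indices_def le_nat_floor of_nat_floor) linarith+

lemma ap_window_eq:
  "ap_window N \<epsilon>\<^sub>1 a b j =
     {b + a * int j - \<lfloor>real N powr \<epsilon>\<^sub>1\<rfloor> .. b + a * int j + \<lfloor>real N powr \<epsilon>\<^sub>1\<rfloor>}"
proof (rule set_eqI)
  fix n
  let ?c = "b + a * int j" and ?s = "real N powr \<epsilon>\<^sub>1"
  have "real_of_int ?c - ?s \<le> real_of_int n \<longleftrightarrow> real_of_int (?c - n) \<le> ?s"
    "real_of_int n \<le> real_of_int ?c + ?s \<longleftrightarrow> real_of_int (n - ?c) \<le> ?s"
    unfolding of_int_diff by linarith+
  then have "n \<in> ap_window N \<epsilon>\<^sub>1 a b j \<longleftrightarrow> ?c - n \<le> \<lfloor>?s\<rfloor> \<and> n - ?c \<le> \<lfloor>?s\<rfloor>"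
    unfolding ap_window_def le_floor_iff by simp
  then show "n \<in> ap_window N \<epsilon>\<^sub>1 a b j \<longleftrightarrow> n \<in> {?c - \<lfloor>?s\<rfloor> .. ?c + \<lfloor>?s\<rfloor>}" by auto
qed

lemma finite_ap_window: "finite (ap_window N \<epsilon>\<^sub>1 a b j)"
  by (simp add: ap_window_eq)

lemma card_ap_window_ge: "real N powr \<epsilon>\<^sub>1 \<le> card (ap_window N \<epsilon>\<^sub>1 a b j)"
proof -
  have c: "real (card (ap_window N \<epsilon>\<^sub>1 a b j)) = 2 * real_of_int \<lfloor>real N powr \<epsilon>\<^sub>1\<rfloor> + 1"
    by (simp add: ap_window_eq)
  have "0 \<le> real_of_int \<lfloor>real N powr \<epsilon>\<^sub>1\<rfloor>" by simp
  then show ?thesis unfolding c by linarith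
qed

lemma ap_window_nonempty: "ap_window N \<epsilon>\<^sub>1 a b j \<noteq> {}"
  by (simp add: ap_window_eq)

lemma disjoint_ap_windows:
  assumes "real N powr \<epsilon>\<^sub>1 < real_of_int a / 2"
  shows "disjoint_family_on (ap_window N \<epsilon>\<^sub>1 a b) J"
proof -
  have a0: "a > 0" using assms powr_ge_zero[of "real N" \<epsilon>\<^sub>1] by linarith
  have "ap_window N \<epsilon>\<^sub>1 a b i \<inter> ap_window N \<epsilon>\<^sub>1 a b j = {}" if "i < j" for i j
  proof -
    have "a * (int i + 1) \<le> a * int j" using that a0 by (intro mult_left_mono) auto
    then have "real_of_int (a * (int i + 1)) \<le> real_of_int (a * int j)" by (simp only: of_int_le_iff)
    then have "real_of_int (a * int i) + a \<le> real_of_int (a * int j)" by (simp add: distrib_left)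
    then show ?thesis using assms by (auto simp: ap_window_def)
  qed
  then show ?thesis unfolding disjoint_family_on_def by (metis Int_commute nat_neq_iff)
qed

text \<open>The factor \<open>L\<^sup>2\<close> is one \<open>L\<close> from the probability of the rare event times another from the trivial bound
  on the supremum.\<close>
lemma mult_exp_neg_cbrt_le:
  assumes L: "(L::real) \<ge> 1"
  shows "L\<^sup>2 * exp (- (L powr (1/3))) \<le> 6 ^ 6"
proof -
  have "L\<^sup>2 = (L powr (1/3)) powr 6" using L by (simp add: powr_powr)
  also have "\<dots> \<le> 6 powr 6 * exp (L powr (1/3))" by (rule powr_le_exp) auto
  finally show ?thesis by (simp add: exp_minus field_simps)
qed

text \<open>The \<open>p\<close>-th powers of the two lower bounds for the majorant enter with the constants that the two
  conditions on \<open>Y\<close> attach to them; \<open>1024 * 2 powr p\<close> is the inverse of the constant in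
  \<open>majorant_norm_perturbed_progression_ge\<close>.\<close>
definition majorant_const :: "real \<Rightarrow> real" where
  "majorant_const p = (threshold p powr p + 4 * 5 powr p / density_const * (1024 * 2 powr p)) powr (1 / p)"

text \<open>The two regimes of the lower bound for the majorant match the two conditions on \<open>Y\<close>: multiplied by
  \<open>sqrt L\<close>, the constant part of \<open>Y\<close> is compared with \<open>majorant_norm_ge_sqrt_card\<close>, the other part
  with \<open>majorant_norm_perturbed_progression_ge\<close>.\<close>
lemma random_perturbation_majorant:
  assumes p: "p > 2" and e1: "\<epsilon>\<^sub>1 > 0" and e0: "\<epsilon>\<^sub>0 > 0"
    and adm: "admissible N \<epsilon>\<^sub>0 \<epsilon>\<^sub>1 a b" and rp: "random_perturbation M \<eta> N \<epsilon>\<^sub>0 \<epsilon>\<^sub>1 a b"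
  defines "L \<equiv> real (nat \<lfloor>real N powr \<epsilon>\<^sub>0\<rfloor>)"
  obtains E where "E \<in> sets M" "measure M E \<le> L * exp (- (L powr (1/3)))"
    "AE \<omega> in M. sup_norm p (random_set \<eta> N \<epsilon>\<^sub>0 \<omega>) \<le> L \<and>
       1 \<le> majorant_norm p (random_set \<eta> N \<epsilon>\<^sub>0 \<omega>) \<and> majorant_norm p (random_set \<eta> N \<epsilon>\<^sub>0 \<omega>) \<le> L \<and>
       (\<omega> \<notin> E \<longrightarrow> sup_norm p (random_set \<eta> N \<epsilon>\<^sub>0 \<omega>) \<le> majorant_const p * majorant_norm p (random_set \<eta> N \<epsilon>\<^sub>0 \<omega>))"
proof -
  interpret prob_space M using rp by (simp add: random_perturbation_def)
  define l where "l = nat \<lfloor>real N powr \<epsilon>\<^sub>0\<rfloor>"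
  define J where "J = ap_indices N \<epsilon>\<^sub>0"
  define I where "I = ap_window N \<epsilon>\<^sub>1 a b"
  define s where "s = real N powr \<epsilon>\<^sub>1"
  have N: "N \<ge> 1" and ab: "0 < b" "b < a" and sa: "s < a / 2"
    using adm by (auto simp: admissible_def s_def)
  have s1: "1 \<le> s" using N e1 by (simp add: s_def ge_one_powr_ge_zero)
  have "1 \<le> real N powr \<epsilon>\<^sub>0" using N e0 by (simp add: ge_one_powr_ge_zero)
  then have l1: "1 \<le> l" by (simp add: l_def le_nat_floor)
  have Jl: "J = {1..l}" by (simp add: J_def l_def ap_indices_eq)
  have J: "finite J" "J \<noteq> {}" "card J = l" using l1 by (auto simp: Jl)
  have indep: "indep_vars (\<lambda>_. count_space UNIV) \<eta> J"
    and distr: "\<And>j. j \<in> J \<Longrightarrow> distr M (count_space UNIV) (\<eta> j) = measure_pmf (pmf_of_set (I j))"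
    using rp by (auto simp: random_perturbation_def J_def I_def)
  have finI: "finite (I j)" and neI: "I j \<noteq> {}" and cardI: "s \<le> card (I j)" for j
    by (simp_all add: I_def finite_ap_window ap_window_nonempty s_def card_ap_window_ge)
  have meas: "\<eta> j \<in> measurable M (count_space UNIV)" if "j \<in> J" for j
    using indep that by (auto simp: indep_vars_def)
  have prob_eq: "prob {\<omega>\<in>space M. \<eta> j \<omega> = n} = pmf (pmf_of_set (I j)) n" if j: "j \<in> J" for j n
  proof -
    have "pmf (pmf_of_set (I j)) n = measure (distr M (count_space UNIV) (\<eta> j)) {n}"
      by (simp add: distr[OF j] pmf.rep_eq)
    also have "\<dots> = prob {\<omega>\<in>space M. \<eta> j \<omega> = n}"
      using meas[OF j] by (subst measure_distr) (auto simp: vimage_def Int_def conj_commute)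
    finally show ?thesis by simp
  qed
  have unif: "prob {\<omega>\<in>space M. \<eta> j \<omega> = n} \<le> 1 / s" if j: "j \<in> J" for j n
  proof -
    have "pmf (pmf_of_set (I j)) n \<le> 1 / card (I j)"
      using finI neI by (simp add: pmf_of_set indicator_def)
    also have "\<dots> \<le> 1 / s" using cardI[of j] s1 by (intro divide_left_mono mult_pos_pos) linarith+
    finally show ?thesis by (simp add: prob_eq[OF j])
  qed
  have AEI: "AE \<omega> in M. \<eta> j \<omega> \<in> I j" if j: "j \<in> J" for j
  proof -
    have "AE n in distr M (count_space UNIV) (\<eta> j). n \<in> I j"
      unfolding distr[OF j] using finI neI by (simp add: AE_measure_pmf_iff set_pmf_of_set)
    then show ?thesis using meas[OF j] by (subst (asm) AE_distr_iff) auto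
  qed
  have disj: "disjoint_family_on I J"
    unfolding I_def using sa by (intro disjoint_ap_windows) (simp add: s_def)
  define Z where "Z = max (threshold p powr p) (4 * 5 powr p / density_const * (l powr (p/2 - 1) / s))"
  define Y where "Y = Z powr (1 / p)"
  have thr: "threshold p > 0" by (simp add: threshold_def)
  have Z0: "Z > 0" using thr by (simp add: Z_def less_max_iff_disj)
  have Yp: "Y powr p = Z" using p Z0 by (simp add: Y_def powr_powr)
  have "threshold p = (threshold p powr p) powr (1/p)" using thr p by (simp add: powr_powr)
  also have "\<dots> \<le> Y" unfolding Y_def using p by (intro powr_mono2) (auto simp: Z_def)
  finally have Y1: "threshold p \<le> Y" .
  have Y2: "4 * 5 powr p / density_const * (card J powr (p/2 - 1) / s) \<le> Y powr p"
    by (simp add: Yp Z_def J)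
  obtain E where E: "E \<in> events" "prob E \<le> card J * exp (- (card J powr (1/3)))"
    and good: "\<And>\<omega>. \<omega> \<in> space M \<Longrightarrow> (\<And>j. j \<in> J \<Longrightarrow> \<eta> j \<omega> \<in> I j) \<Longrightarrow> \<omega> \<notin> E
       \<Longrightarrow> sup_norm p ((\<lambda>j. \<eta> j \<omega>) ` J) \<le> Y * sqrt (card J)"
    using sup_norm_le_outside_rare_event[OF p J(1,2) indep finI AEI disj _ unif Y1 Y2] s1 by auto
  have main: "sup_norm p (random_set \<eta> N \<epsilon>\<^sub>0 \<omega>) \<le> L \<and>
       1 \<le> majorant_norm p (random_set \<eta> N \<epsilon>\<^sub>0 \<omega>) \<and> majorant_norm p (random_set \<eta> N \<epsilon>\<^sub>0 \<omega>) \<le> L \<and>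
       (\<omega> \<notin> E \<longrightarrow> sup_norm p (random_set \<eta> N \<epsilon>\<^sub>0 \<omega>) \<le> majorant_const p * majorant_norm p (random_set \<eta> N \<epsilon>\<^sub>0 \<omega>))"
    if \<omega>: "\<omega> \<in> space M" "\<And>j. j \<in> J \<Longrightarrow> \<eta> j \<omega> \<in> I j" for \<omega>
  proof -
    let ?h = "\<lambda>j. \<eta> j \<omega>"
    let ?S = "?h ` J"
    let ?m = "majorant_norm p ?S"
    have S: "random_set \<eta> N \<epsilon>\<^sub>0 \<omega> = ?S" by (simp add: random_set_def J_def)
    have inj: "inj_on ?h J"
    proof (rule inj_onI, rule ccontr)
      fix i j assume "i \<in> J" "j \<in> J" "?h i = ?h j" "i \<noteq> j"
      then show False using \<omega>(2)[of i] \<omega>(2)[of j] disj unfolding disjoint_family_on_def by (metis IntI empty_iff)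
    qed
    have cS: "card ?S = l" using inj J by (simp add: card_image)
    have finS: "finite ?S" using J by simp
    have up: "sup_norm p ?S \<le> L" using sup_norm_le_card[of p ?S] p by (simp add: cS L_def l_def)
    have m_le: "?m \<le> L"
      using Lp_norm_exp_sum_le_card[of p "\<lambda>_. 1" ?S] p by (simp add: majorant_norm_def cS L_def l_def)
    have sq: "sqrt l \<le> ?m" using majorant_norm_ge_sqrt_card[OF p finS] by (simp add: cS)
    have m1: "1 \<le> ?m" using sq l1 by (smt (verit) real_sqrt_ge_1_iff of_nat_1 of_nat_mono)
    have low: "(real l / 2) powr p / (1024 * s * l) \<le> ?m powr p"
      unfolding Jl
    proof (rule majorant_norm_perturbed_progression_ge[OF _ ab s1 sa l1])
      show "\<bar>real_of_int (\<eta> j \<omega> - (b + a * int j))\<bar> \<le> s" if "j \<in> {1..l}" for j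
        using \<omega>(2)[of j] that by (auto simp: Jl I_def ap_window_def s_def)
    qed (use p inj Jl in auto)
    have "sup_norm p ?S \<le> majorant_const p * ?m" if nE: "\<omega> \<notin> E"
    proof -
      have "sup_norm p ?S \<le> Y * sqrt l" using good[OF \<omega> nE] J by simp
      also have "Y * sqrt l = (Z * sqrt l powr p) powr (1/p)"
        using p Z0 l1 by (simp add: Y_def powr_mult powr_powr)
      also have "\<dots> \<le> ((threshold p powr p + 4 * 5 powr p / density_const * (1024 * 2 powr p)) * ?m powr p) powr (1/p)"
      proof (intro powr_mono2)
        have "sqrt l powr p = l powr (p/2)" using l1 by (simp add: powr_powr flip: powr_half_sqrt)
        then have "l powr (p/2 - 1) / s * sqrt l powr p = l powr (p - 1) / s"
          by (simp flip: powr_add)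
        also have "\<dots> = 1024 * 2 powr p * ((real l / 2) powr p / (1024 * s * l))"
          using l1 by (simp add: powr_divide powr_diff)
        also have "\<dots> \<le> 1024 * 2 powr p * ?m powr p" using low by (intro mult_left_mono) auto
        finally have A: "l powr (p/2 - 1) / s * sqrt l powr p \<le> 1024 * 2 powr p * ?m powr p" .
        have "4 * 5 powr p / density_const * (l powr (p/2 - 1) / s) * sqrt l powr p
            \<le> 4 * 5 powr p / density_const * (1024 * 2 powr p) * ?m powr p"
          using mult_left_mono[OF A, of "4 * 5 powr p / density_const"] by (simp add: density_const_def mult_ac)
        moreover have "threshold p powr p * sqrt l powr p \<le> threshold p powr p * ?m powr p"
          using sq p by (intro mult_left_mono powr_mono2) auto
        moreover have "0 \<le> threshold p powr p * ?m powr p" "0 \<le> 4 * 5 powr p / density_const * (1024 * 2 powr p) * ?m powr p"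
          by (simp_all add: density_const_def)
        ultimately show "Z * sqrt l powr p \<le> (threshold p powr p + 4 * 5 powr p / density_const * (1024 * 2 powr p)) * ?m powr p"
          unfolding Z_def by (simp only: distrib_right max_def split: if_split) linarith
      qed (use p Z0 in auto)
      also have "\<dots> = majorant_const p * ?m"
        using p m1 by (simp add: majorant_const_def powr_mult powr_powr density_const_def)
      finally show ?thesis .
    qed
    then show ?thesis unfolding S using up m1 m_le by blast
  qed
  have "AE \<omega> in M. \<forall>j\<in>J. \<eta> j \<omega> \<in> I j" using J AEI by (intro AE_finite_allI) auto
  then have "AE \<omega> in M. sup_norm p (random_set \<eta> N \<epsilon>\<^sub>0 \<omega>) \<le> L \<and>
       1 \<le> majorant_norm p (random_set \<eta> N \<epsilon>\<^sub>0 \<omega>) \<and> majorant_norm p (random_set \<eta> N \<epsilon>\<^sub>0 \<omega>) \<le> L \<and>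
       (\<omega> \<notin> E \<longrightarrow> sup_norm p (random_set \<eta> N \<epsilon>\<^sub>0 \<omega>) \<le> majorant_const p * majorant_norm p (random_set \<eta> N \<epsilon>\<^sub>0 \<omega>))"
    using AE_space by eventually_elim (rule main, auto)
  moreover have "prob E \<le> L * exp (- (L powr (1/3)))" using E(2) by (simp add: J L_def l_def)
  ultimately show ?thesis by (rule that[OF E(1), rotated])
qed

text \<open>The values are finite sets of integers, and there are only countably many of these. So every
  function of the random set is measurable.\<close>
lemma random_set_measurable:
  assumes rp: "random_perturbation M \<eta> N \<epsilon>\<^sub>0 \<epsilon>\<^sub>1 a b"
  shows "random_set \<eta> N \<epsilon>\<^sub>0 \<in> measurable M (count_space {S. finite S})"
proof -
  interpret prob_space M using rp by (simp add: random_perturbation_def)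
  define J where "J = ap_indices N \<epsilon>\<^sub>0"
  have finJ: "finite J" by (simp add: J_def ap_indices_eq)
  have meas: "\<eta> j \<in> measurable M (count_space UNIV)" if "j \<in> J" for j
    using rp that by (auto simp: random_perturbation_def indep_vars_def J_def)
  have ev: "{\<omega>\<in>space M. Q (\<eta> j \<omega>)} \<in> events" if "j \<in> J" for j Q
    using measurable_sets[OF meas[OF that], of "{n. Q n}"] by (simp add: vimage_def Int_def conj_commute)
  have "random_set \<eta> N \<epsilon>\<^sub>0 -` {S} \<inter> space M \<in> events" if "finite S" for S
  proof -
    have "random_set \<eta> N \<epsilon>\<^sub>0 -` {S} \<inter> space M
       = {\<omega>\<in>space M. \<forall>j\<in>J. \<eta> j \<omega> \<in> S} \<inter> {\<omega>\<in>space M. \<forall>n\<in>S. \<exists>j\<in>J. \<eta> j \<omega> = n}"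
    proof -
      have "f ` J = S \<longleftrightarrow> (\<forall>j\<in>J. f j \<in> S) \<and> (\<forall>n\<in>S. \<exists>j\<in>J. f j = n)" for f :: "nat \<Rightarrow> int"
        unfolding set_eq_subset image_subset_iff subset_eq[of S] image_iff
        by (intro arg_cong2[of _ _ _ _ "(\<and>)"] refl ball_cong bex_cong eq_commute)
      then show ?thesis by (simp only: random_set_def J_def[symmetric] set_eq_iff vimage_eq Int_iff singleton_iff mem_Collect_eq) blast
    qed
    also have "\<dots> \<in> events"
      using finJ that by (intro sets.Int sets.sets_Collect_finite_All sets.sets_Collect_finite_Ex ev) auto
    finally show ?thesis .
  qed
  then show ?thesis
    by (subst measurable_count_space_eq_countable)
       (auto simp: countable_Collect_finite random_set_def ap_indices_eq)
qed

theorem theorem3p3: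
  fixes p \<epsilon>\<^sub>0 \<epsilon>\<^sub>1 :: real
  assumes "p > 2" and "\<epsilon>\<^sub>0 > 0" and "\<epsilon>\<^sub>1 > 0"
  shows "(\<exists>C\<^sub>p::real. \<forall>N a b. \<forall>(M :: 'w measure) \<eta>.
            admissible N \<epsilon>\<^sub>0 \<epsilon>\<^sub>1 a b \<and> random_perturbation M \<eta> N \<epsilon>\<^sub>0 \<epsilon>\<^sub>1 a b \<longrightarrow>
              (\<integral>\<omega>. sup_norm p (random_set \<eta> N \<epsilon>\<^sub>0 \<omega>) \<partial>M)
                \<le> C\<^sub>p * (\<integral>\<omega>. majorant_norm p (random_set \<eta> N \<epsilon>\<^sub>0 \<omega>) \<partial>M)) \<and>
         (\<forall>\<gamma>>0. \<exists>C C' :: real. \<forall>N a b. \<forall>(M :: 'w measure) \<eta>.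
            real N \<ge> C' \<and> admissible N \<epsilon>\<^sub>0 \<epsilon>\<^sub>1 a b \<and> random_perturbation M \<eta> N \<epsilon>\<^sub>0 \<epsilon>\<^sub>1 a b \<longrightarrow>
              \<P>(\<omega> in M. sup_norm p (random_set \<eta> N \<epsilon>\<^sub>0 \<omega>)
                          \<ge> C * majorant_norm p (random_set \<eta> N \<epsilon>\<^sub>0 \<omega>)) \<le> \<gamma>)"
proof (intro conjI allI impI)
  have C0: "majorant_const p \<ge> 0" by (simp add: majorant_const_def)
  show "\<exists>C\<^sub>p::real. \<forall>N a b. \<forall>(M :: 'w measure) \<eta>.
            admissible N \<epsilon>\<^sub>0 \<epsilon>\<^sub>1 a b \<and> random_perturbation M \<eta> N \<epsilon>\<^sub>0 \<epsilon>\<^sub>1 a b \<longrightarrow>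
              (\<integral>\<omega>. sup_norm p (random_set \<eta> N \<epsilon>\<^sub>0 \<omega>) \<partial>M)
                \<le> C\<^sub>p * (\<integral>\<omega>. majorant_norm p (random_set \<eta> N \<epsilon>\<^sub>0 \<omega>) \<partial>M)"
  proof (intro exI allI impI, elim conjE)
    fix N a b and M :: "'w measure" and \<eta>
    assume adm: "admissible N \<epsilon>\<^sub>0 \<epsilon>\<^sub>1 a b" and rp: "random_perturbation M \<eta> N \<epsilon>\<^sub>0 \<epsilon>\<^sub>1 a b"
    interpret prob_space M using rp by (simp add: random_perturbation_def)
    let ?s = "\<lambda>\<omega>. sup_norm p (random_set \<eta> N \<epsilon>\<^sub>0 \<omega>)"
    let ?m = "\<lambda>\<omega>. majorant_norm p (random_set \<eta> N \<epsilon>\<^sub>0 \<omega>)"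
    define L where "L = real (nat \<lfloor>real N powr \<epsilon>\<^sub>0\<rfloor>)"
    obtain E where E: "E \<in> events" "prob E \<le> L * exp (- (L powr (1/3)))"
      and AE: "AE \<omega> in M. ?s \<omega> \<le> L \<and> 1 \<le> ?m \<omega> \<and> ?m \<omega> \<le> L \<and> (\<omega> \<notin> E \<longrightarrow> ?s \<omega> \<le> majorant_const p * ?m \<omega>)"
      by (rule random_perturbation_majorant[OF assms(1,3,2) adm rp, folded L_def])
    have L1: "L \<ge> 1"
    proof -
      have "1 \<le> real N powr \<epsilon>\<^sub>0" using adm assms by (simp add: admissible_def ge_one_powr_ge_zero)
      then have "(1::nat) \<le> nat \<lfloor>real N powr \<epsilon>\<^sub>0\<rfloor>" by (intro le_nat_floor) simp
      then show ?thesis unfolding L_def by linarith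
    qed
    have mm: "?m \<in> borel_measurable M"
      using random_set_measurable[OF rp] by (rule measurable_compose) simp
    have im: "integrable M ?m"
    proof (rule integrable_const_bound[OF _ mm])
      show "AE \<omega> in M. norm (?m \<omega>) \<le> L" using AE by eventually_elim auto
    qed
    have Em1: "1 \<le> expectation ?m"
    proof -
      have "AE \<omega> in M. 1 \<le> ?m \<omega>" using AE by eventually_elim auto
      then have "expectation (\<lambda>_. 1) \<le> expectation ?m" using im by (intro integral_mono_AE) auto
      then show ?thesis by (simp add: prob_space)
    qed
    have iE: "integrable M (indicat_real E)" "expectation (indicat_real E) = prob E"
      using E(1) by (auto simp: emeasure_eq_measure)
    have "expectation ?s \<le> majorant_const p * expectation ?m + 6 ^ 6"
    \<comment> \<open>If the supremum were not integrable, its integral would be zero by convention.\<close>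
    proof (cases "integrable M ?s")
      case True
      have "expectation ?s \<le> expectation (\<lambda>\<omega>. majorant_const p * ?m \<omega> + L * indicator E \<omega>)"
      proof (rule integral_mono_AE)
        show "integrable M (\<lambda>\<omega>. majorant_const p * ?m \<omega> + L * indicator E \<omega>)"
          by (intro Bochner_Integration.integrable_add integrable_mult_right im iE)
        show "AE \<omega> in M. ?s \<omega> \<le> majorant_const p * ?m \<omega> + L * indicator E \<omega>"
          using AE
        proof eventually_elim
          case (elim \<omega>)
          moreover have "0 \<le> majorant_const p * ?m \<omega>" using elim C0 by auto
          ultimately show ?case by (cases "\<omega> \<in> E") auto
        qed
      qed fact
      also have "\<dots> = majorant_const p * expectation ?m + L * prob E"
        using im iE by (subst Bochner_Integration.integral_add) auto
      also have "L * prob E \<le> L * (L * exp (- (L powr (1/3))))" using E L1 by (intro mult_left_mono) auto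
      also have "\<dots> \<le> 6 ^ 6" using mult_exp_neg_cbrt_le[OF L1] by (simp add: power2_eq_square)
      finally show ?thesis by simp
    next
      case False
      then show ?thesis using C0 Em1 by (simp add: not_integrable_integral_eq)
    qed
    also have "\<dots> \<le> (majorant_const p + 6 ^ 6) * expectation ?m"
      using Em1 by (simp add: algebra_simps)
    finally show "expectation ?s \<le> (majorant_const p + 6 ^ 6) * expectation ?m" .
  qed
next
  fix \<gamma> :: real assume \<gamma>: "\<gamma> > 0"
  show "\<exists>C C' :: real. \<forall>N a b. \<forall>(M :: 'w measure) \<eta>.
            real N \<ge> C' \<and> admissible N \<epsilon>\<^sub>0 \<epsilon>\<^sub>1 a b \<and> random_perturbation M \<eta> N \<epsilon>\<^sub>0 \<epsilon>\<^sub>1 a b \<longrightarrow>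
              \<P>(\<omega> in M. sup_norm p (random_set \<eta> N \<epsilon>\<^sub>0 \<omega>)
                          \<ge> C * majorant_norm p (random_set \<eta> N \<epsilon>\<^sub>0 \<omega>)) \<le> \<gamma>"
  proof (intro exI allI impI, elim conjE)
    fix N a b and M :: "'w measure" and \<eta>
    \<comment> \<open>The added \<open>1\<close> makes up for rounding \<open>N powr \<epsilon>\<^sub>0\<close> down to \<open>L\<close>.\<close>
    assume N: "(6 ^ 6 / \<gamma> + 1) powr (1 / \<epsilon>\<^sub>0) \<le> real N"
      and adm: "admissible N \<epsilon>\<^sub>0 \<epsilon>\<^sub>1 a b" and rp: "random_perturbation M \<eta> N \<epsilon>\<^sub>0 \<epsilon>\<^sub>1 a b"
    interpret prob_space M using rp by (simp add: random_perturbation_def)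
    let ?s = "\<lambda>\<omega>. sup_norm p (random_set \<eta> N \<epsilon>\<^sub>0 \<omega>)"
    let ?m = "\<lambda>\<omega>. majorant_norm p (random_set \<eta> N \<epsilon>\<^sub>0 \<omega>)"
    define L where "L = real (nat \<lfloor>real N powr \<epsilon>\<^sub>0\<rfloor>)"
    obtain E where E: "E \<in> events" "prob E \<le> L * exp (- (L powr (1/3)))"
      and AE: "AE \<omega> in M. ?s \<omega> \<le> L \<and> 1 \<le> ?m \<omega> \<and> ?m \<omega> \<le> L \<and> (\<omega> \<notin> E \<longrightarrow> ?s \<omega> \<le> majorant_const p * ?m \<omega>)"
      by (rule random_perturbation_majorant[OF assms(1,3,2) adm rp, folded L_def])
    have "6 ^ 6 / \<gamma> + 1 = ((6 ^ 6 / \<gamma> + 1) powr (1 / \<epsilon>\<^sub>0)) powr \<epsilon>\<^sub>0"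
      using assms \<gamma> by (simp add: powr_powr add_pos_pos)
    also have "\<dots> \<le> real N powr \<epsilon>\<^sub>0" using N assms by (intro powr_mono2) auto
    finally have L6: "6 ^ 6 / \<gamma> \<le> L" unfolding L_def by linarith
    have "1 \<le> real N powr \<epsilon>\<^sub>0" using adm assms by (simp add: admissible_def ge_one_powr_ge_zero)
    then have "(1::nat) \<le> nat \<lfloor>real N powr \<epsilon>\<^sub>0\<rfloor>" by (intro le_nat_floor) simp
    then have L1: "L \<ge> 1" unfolding L_def by linarith
    have "L * (L * exp (- (L powr (1/3)))) \<le> 6 ^ 6" using mult_exp_neg_cbrt_le[OF L1] by (simp add: power2_eq_square)
    also have "\<dots> \<le> L * \<gamma>" using L6 \<gamma> by (simp add: field_simps)
    finally have small: "L * exp (- (L powr (1/3))) \<le> \<gamma>" using L1 by (simp add: mult_le_cancel_left)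
    \<comment> \<open>The majorant is positive, so adding \<open>1\<close> to the constant makes the inequality strict.\<close>
    let ?A = "{\<omega>\<in>space M. (majorant_const p + 1) * ?m \<omega> \<le> ?s \<omega>}"
    have "prob ?A \<le> prob E"
    proof (rule finite_measure_mono_AE)
      show "AE \<omega> in M. \<omega> \<in> ?A \<longrightarrow> \<omega> \<in> E"
        using AE by eventually_elim (auto simp: algebra_simps)
    qed (rule E)
    then show "prob ?A \<le> \<gamma>" using E small by linarith
  qed
qed

end
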